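(* Let $\mathbb{T}$ be a time scale with graininess function $\mu$, let $a\in\mathbb{T}$, let $\alpha,\beta\in\mathbb{R}$, let $k\ge 1$ be an integer, and let $\gamma_0,\dots,\gamma_k\in\mathbb{R}$. Assume that $\beta\neq 0$, $\beta\neq\alpha^2$, and $1-2\alpha\mu(t)+\beta\mu(t)^2\neq 0$ for all $t\in\mathbb{T}^\kappa$. Then a general solution of the second-order linear constant coefficient dynamic equation $$y^{\Delta\Delta}+2\alpha y^{\Delta}+\beta y=\sum_{i=0}^{k}\gamma_i h_i(\cdot,a)$$ is given by $$y(t)=c_1e_{\lambda_1}(t,a)+c_2e_{\lambda_2}(t,a)+\sum_{i=0}^{k}\xi_i h_i(t,a),$$ with arbitrary constants $c_1,c_2$ (that is, every function of this form is a solution, and every solution is of this form), where $$\lambda_1=-\alpha-\sqrt{\alpha^2-\beta},\qquad \lambda_2=-\alpha+\sqrt{\alpha^2-\beta},$$ $$\xi_{k-1}=\frac{1}{\beta}\left(\gamma_{k-1}-\frac{2\alpha}{\beta}\gamma_k\right),\qquad \xi_k=\frac{1}{\beta}\gamma_k,$$ $$\xi_i=\omega_1\lambda_1^i+\omega_2\lambda_2^i+\sum_{\tau=0}^{i-1}\sum_{s=0}^{\tau-1}\gamma_s\lambda_1^{i+s-2\tau}\beta^{\tau-1-s}\quad\text{for } i\in\{0,\dots,k-2\},$$ and $$\begin{bmatrix}\omega_1\\ \omega_2\end{bmatrix}=\frac{1}{2\beta^{k-1}\sqrt{\alpha^2-\beta}}\begin{bmatrix}\lambda_2^k & -\lambda_2^{k-1}\\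 -\lambda_1^k & \lambda_1^{k-1}\end{bmatrix}\begin{bmatrix}\dfrac{1}{\beta}\left(\gamma_{k-1}-\dfrac{2\alpha}{\beta}\gamma_k\right)-\displaystyle\sum_{\tau=0}^{k-2}\sum_{s=0}^{\tau-1}\gamma_s\lambda_1^{k-1+s-2\tau}\beta^{\tau-1-s}\\ \dfrac{1}{\beta}\gamma_k-\displaystyle\sum_{\tau=0}^{k-1}\sum_{s=0}^{\tau-1}\gamma_s\lambda_1^{k+s-2\tau}\beta^{\tau-1-s}\end{bmatrix}.$$
   Context: A time scale $\mathbb{T}$ is a nonempty closed subset of $\mathbb{R}$; as usual for second-order equations it is assumed to have at least three points. The forward jump operator is $\sigma(t)=\inf\{s\in\mathbb{T}:s>t\}$ (with $\sigma(t)=t$ if $t=\max\mathbb{T}$), and the graininess is $\mu(t)=\sigma(t)-t$. The set $\mathbb{T}^\kappa$ is $\mathbb{T}\setminus\{M\}$ if $\mathbb{T}$ has a maximum $M$ that is left-scattered (i.e. $\sup\{s\in\mathbb{T}:s<M\}<M$), and $\mathbb{T}^\kappa=\mathbb{T}$ otherwise; $\mathbb{T}^{\kappa^2}=(\mathbb{T}^\kappa)^\kappa$. For $f$ defined on $\mathbb{T}$ and $t\in\mathbb{T}^\kappa$, the delta derivative $f^\Delta(t)$ is the number (when it exists) such that for every $\varepsilon>0$ there is a neighborhood $U$ of $t$ with $|f(\sigma(t))-f(s)-f^\Delta(t)(\sigma(t)-s)|\le\varepsilon|\sigma(t)-s|$ for all $s\in U\cap\mathbb{T}$. Also $f^{\Delta\Delta}=(f^\Delta)^\Delta$,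 defined on $\mathbb{T}^{\kappa^2}$. The dynamic equation is required to hold on $\mathbb{T}^{\kappa^2}$, and a solution is a twice delta differentiable function $y$ on $\mathbb{T}$ satisfying it there. The delta integral is given by $\int_a^t f(\tau)\,\Delta\tau=F(t)-F(a)$, where $F^\Delta=f$ on $\mathbb{T}^\kappa$. The time scale polynomials are $h_0(t,a)\equiv 1$ and, for $j\ge1$, $h_j(t,a)=\int_a^t h_{j-1}(\tau,a)\,\Delta\tau$. For a constant $\lambda$ with $1+\lambda\mu(t)\ne0$ for all $t\in\mathbb{T}^\kappa$, the time scale exponential $e_\lambda(\cdot,a)$ is the unique solution of the initial value problem $y^\Delta=\lambda y$ on $\mathbb{T}^\kappa$, $y(a)=1$. Empty sums are zero. If $\alpha^2<\beta$, then $\sqrt{\alpha^2-\beta}$ denotes a fixed complex square root, and solutions, exponentials and the constants $c_1,c_2$ are taken to be complex-valued. *)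

theory Defs
  imports "HOL-Analysis.Analysis"
begin

definition time_scale :: "real set \<Rightarrow> bool" where
  "time_scale T \<longleftrightarrow> T \<noteq> {} \<and> closed T"

definition ts_sigma :: "real set \<Rightarrow> real \<Rightarrow> real" where
  "ts_sigma T t = (if \<exists>s\<in>T. s > t then Inf {s \<in> T. s > t} else t)"

definition ts_mu :: "real set \<Rightarrow> real \<Rightarrow> real" where
  "ts_mu T t = ts_sigma T t - t"

text \<open>The first conjunct renders the usual convention that the supremum over the empty set
  is the minimum of the time scale, so that a least point is never left-scattered.\<close>

definition left_scattered :: "real set \<Rightarrow> real \<Rightarrow> bool" where
  "left_scattered T t \<longleftrightarrow> (\<exists>s\<in>T. s < t) \<and> Sup {s \<in> T. s < t} < t"

definition ts_kappa :: "real set \<Rightarrow> real set" where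
  "ts_kappa T = {t \<in> T. \<not> ((\<forall>s\<in>T. s \<le> t) \<and> left_scattered T t)}"

text \<open>A function on a time scale is represented by a total function on the reals of which only the
  values on the time scale are used.\<close>

definition has_delta_derivative ::
    "real set \<Rightarrow> (real \<Rightarrow> 'a::real_normed_vector) \<Rightarrow> 'a \<Rightarrow> real \<Rightarrow> bool" where
  "has_delta_derivative T f D t \<longleftrightarrow>
     (\<forall>\<epsilon>>0. \<exists>U. open U \<and> t \<in> U \<and>
        (\<forall>s\<in>U \<inter> T. norm (f (ts_sigma T t) - f s - (ts_sigma T t - s) *\<^sub>R D)
                       \<le> \<epsilon> * \<bar>ts_sigma T t - s\<bar>))"

definition delta_differentiable :: "real set \<Rightarrow> (real \<Rightarrow> 'a::real_normed_vector) \<Rightarrow> bool" where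
  "delta_differentiable T f \<longleftrightarrow> (\<forall>t\<in>ts_kappa T. \<exists>D. has_delta_derivative T f D t)"

definition delta_deriv :: "real set \<Rightarrow> (real \<Rightarrow> 'a::real_normed_vector) \<Rightarrow> real \<Rightarrow> 'a" where
  "delta_deriv T f t = (THE D. has_delta_derivative T f D t)"

definition delta_integral ::
    "real set \<Rightarrow> (real \<Rightarrow> 'a::real_normed_vector) \<Rightarrow> real \<Rightarrow> real \<Rightarrow> 'a" where
  "delta_integral T f a t =
     (THE I. \<exists>F. (\<forall>\<tau>\<in>ts_kappa T. has_delta_derivative T F (f \<tau>) \<tau>) \<and> I = F t - F a)"

fun ts_poly :: "real set \<Rightarrow> nat \<Rightarrow> real \<Rightarrow> real \<Rightarrow> real" where
  "ts_poly T 0 t a = 1"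
| "ts_poly T (Suc j) t a = delta_integral T (\<lambda>\<tau>. ts_poly T j \<tau> a) a t"

text \<open>The value at \<open>t\<close> of the solution of \<open>y\<^sup>\<Delta> = \<lambda> y\<close>, \<open>y(a) = 1\<close>; the description ranges over the value
  rather than over \<open>y\<close> because the solution is unique on \<open>T\<close> only.\<close>

definition ts_exp :: "real set \<Rightarrow> 'a::real_normed_field \<Rightarrow> real \<Rightarrow> real \<Rightarrow> 'a" where
  "ts_exp T l t a =
     (THE v. \<exists>y. (\<forall>\<tau>\<in>ts_kappa T. has_delta_derivative T y (l * y \<tau>) \<tau>) \<and> y a = 1 \<and> v = y t)"

text \<open>The function \<open>y\<^sup>\<Delta>\<close> lives on the time scale \<open>ts_kappa T\<close> only, so its delta derivative is formed
  with the jump operator of \<open>ts_kappa T\<close>. This matters only if \<open>T\<close> has a left-scattered maximum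
  whose predecessor is left-dense.\<close>

definition dynamic_solution ::
    "real set \<Rightarrow> real \<Rightarrow> real \<Rightarrow> (real \<Rightarrow> 'a::real_normed_field) \<Rightarrow> (real \<Rightarrow> 'a) \<Rightarrow> bool" where
  "dynamic_solution T \<alpha> \<beta> f y \<longleftrightarrow>
     delta_differentiable T y \<and>
     delta_differentiable (ts_kappa T) (delta_deriv T y) \<and>
     (\<forall>t\<in>ts_kappa (ts_kappa T).
        delta_deriv (ts_kappa T) (delta_deriv T y) t
          + 2 * of_real \<alpha> * delta_deriv T y t + of_real \<beta> * y t = f t)"

text \<open>Below, \<open>r\<close> is the chosen square root of \<open>\<alpha>\<^sup>2 - \<beta>\<close>, in the real or the complex field.\<close>

definition lambda1 :: "real \<Rightarrow> 'a::real_normed_field \<Rightarrow> 'a" where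
  "lambda1 \<alpha> r = - of_real \<alpha> - r"

definition lambda2 :: "real \<Rightarrow> 'a::real_normed_field \<Rightarrow> 'a" where
  "lambda2 \<alpha> r = - of_real \<alpha> + r"

text \<open>The exponent of \<open>\<lambda>\<^sub>1\<close> may be negative; that of \<open>\<beta>\<close> is not, as \<open>s < \<tau>\<close>.\<close>

definition double_sum ::
    "real \<Rightarrow> real \<Rightarrow> (nat \<Rightarrow> real) \<Rightarrow> 'a::real_normed_field \<Rightarrow> nat \<Rightarrow> 'a" where
  "double_sum \<alpha> \<beta> \<gamma> r m =
     (\<Sum>\<tau><m. \<Sum>s<\<tau>. of_real (\<gamma> s) * lambda1 \<alpha> r powi (int m + int s - 2 * int \<tau>)
                    * of_real \<beta> ^ (\<tau> - 1 - s))"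

definition omega ::
    "real \<Rightarrow> real \<Rightarrow> nat \<Rightarrow> (nat \<Rightarrow> real) \<Rightarrow> 'a::real_normed_field \<Rightarrow> 'a ^ 2" where
  "omega \<alpha> \<beta> k \<gamma> r =
     (1 / (2 * of_real \<beta> ^ (k - 1) * r)) *s
       ((vector [vector [lambda2 \<alpha> r ^ k, - (lambda2 \<alpha> r ^ (k - 1))],
                 vector [- (lambda1 \<alpha> r ^ k), lambda1 \<alpha> r ^ (k - 1)]] :: 'a ^ 2 ^ 2)
        *v vector [of_real (1 / \<beta> * (\<gamma> (k - 1) - 2 * \<alpha> / \<beta> * \<gamma> k)) - double_sum \<alpha> \<beta> \<gamma> r (k - 1),
                   of_real (1 / \<beta> * \<gamma> k) - double_sum \<alpha> \<beta> \<gamma> r k])"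

definition xi ::
    "real \<Rightarrow> real \<Rightarrow> nat \<Rightarrow> (nat \<Rightarrow> real) \<Rightarrow> 'a::real_normed_field \<Rightarrow> nat \<Rightarrow> 'a" where
  "xi \<alpha> \<beta> k \<gamma> r i =
     (if i = k then of_real (1 / \<beta> * \<gamma> k)
      else if i = k - 1 then of_real (1 / \<beta> * (\<gamma> (k - 1) - 2 * \<alpha> / \<beta> * \<gamma> k))
      else omega \<alpha> \<beta> k \<gamma> r $ 1 * lambda1 \<alpha> r ^ i + omega \<alpha> \<beta> k \<gamma> r $ 2 * lambda2 \<alpha> r ^ i
             + double_sum \<alpha> \<beta> \<gamma> r i)"

end

theory Submission
  imports Defs
begin

text \<open>
  Let \<open>\<lambda>\<^sub>1, \<lambda>\<^sub>2\<close> be the roots of \<open>x\<^sup>2 + 2 \<alpha> x + \<beta>\<close>. They are distinct because \<open>\<beta> \<noteq> \<alpha>\<^sup>2\<close>, and the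
  condition on the graininess \<open>\<mu>\<close> says that neither \<open>1 + \<lambda>\<^sub>1 \<mu>\<close> nor \<open>1 + \<lambda>\<^sub>2 \<mu>\<close> has a zero, so that both
  exponentials exist. The difference of two solutions solves the homogeneous equation, and the
  homogeneous equation factors into first order equations: if \<open>z\<close> solves it, then \<open>z\<^sup>\<Delta> - \<lambda>\<^sub>2 z\<close> and
  \<open>z\<^sup>\<Delta> - \<lambda>\<^sub>1 z\<close> are multiples of the two exponentials, which determines \<open>z\<close>
  (\<open>homogeneous_solution_form\<close>). It remains to find one solution. As \<open>h\<^sub>0\<close> is constant and \<open>h\<^sub>i\<close> has
  derivative \<open>h\<^sub>i\<^sub>-\<^sub>1\<close> otherwise, the combination with coefficients \<open>\<xi>\<^sub>i\<close> is a solution if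
  \<open>\<xi>\<^sub>i\<^sub>+\<^sub>2 + 2 \<alpha> \<xi>\<^sub>i\<^sub>+\<^sub>1 + \<beta> \<xi>\<^sub>i = \<gamma>\<^sub>i\<close> for \<open>i \<le> k\<close>, where \<open>\<xi>\<^sub>i = 0\<close> for \<open>i > k\<close>. This is a linear
  recurrence run downwards from \<open>k\<close>, and the stated formula is its closed form
  (\<open>xi_polynomial_solution\<close>).

  The objects in the equation are given by descriptions, so existence and uniqueness have to be shown
  for each of them. Uniqueness of antiderivatives comes from a mean value inequality
  (\<open>delta_mean_value_inequality\<close>). Antiderivatives are obtained by extending a function to be constant
  over the gaps of the time scale and integrating over the reals (\<open>delta_antiderivative\<close>). The
  exponential is \<open>exp F\<close>, where \<open>F\<close> is an antiderivative of \<open>Ln (1 + \<lambda> \<mu>) / \<mu>\<close>, read as \<open>\<lambda>\<close> where \<open>\<mu> = 0\<close>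
  (\<open>complex_exponential_exists\<close>). It therefore has no zeros, and uniqueness for the
  first order equation follows by considering quotients (\<open>exponential_solution_multiple\<close>).

  The second derivative is taken relative to \<open>ts_kappa T\<close>, whose jump operator may differ from the one of
  \<open>T\<close> at one point. Continuity of the first derivative makes the two notions compatible
  (\<open>has_delta_derivative_kappa\<close>).
\<close>

section \<open>The jump operator\<close>

lemma sigma_props:
  assumes "closed T" "t \<in> T"
  shows sigma_mem: "ts_sigma T t \<in> T" and sigma_ge: "t \<le> ts_sigma T t"
proof -
  have "ts_sigma T t \<in> T \<and> t \<le> ts_sigma T t"
  proof (cases "\<exists>s\<in>T. s > t")
    case True
    let ?S = "{s \<in> T. s > t}"
    have ne: "?S \<noteq> {}" and bd: "bdd_below ?S"
      using True by (auto intro!: bdd_belowI[of _ t])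
    have "Inf ?S \<in> closure ?S"
      by (rule closure_contains_Inf[OF ne bd])
    also have "closure ?S \<subseteq> T"
      using assms by (intro closure_minimal) auto
    finally show ?thesis
      using True cInf_greatest[OF ne, of t] by (auto simp: ts_sigma_def)
  qed (use assms in \<open>auto simp: ts_sigma_def\<close>)
  then show "ts_sigma T t \<in> T" "t \<le> ts_sigma T t" by auto
qed

lemma sigma_le: "s \<in> T \<Longrightarrow> t < s \<Longrightarrow> ts_sigma T t \<le> s"
  unfolding ts_sigma_def by (auto intro!: cInf_lower bdd_belowI[of _ t])

lemma mu_nonneg: "closed T \<Longrightarrow> t \<in> T \<Longrightarrow> 0 \<le> ts_mu T t"
  using sigma_ge[of T t] by (simp add: ts_mu_def)

lemma right_dense_points:
  assumes "ts_sigma T t = t" "s \<in> T" "t < s" "t < v"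
  obtains u where "u \<in> T" "t < u" "u < v"
proof -
  have "Inf {s \<in> T. s > t} < v"
    using assms by (auto simp: ts_sigma_def split: if_splits)
  then obtain u where "u \<in> {s \<in> T. s > t}" "u < v"
    using assms by (subst (asm) cInf_less_iff) (auto intro!: bdd_belowI[of _ t])
  then show thesis using that by auto
qed

lemma kappa_subset: "ts_kappa T \<subseteq> T"
  by (auto simp: ts_kappa_def)

lemma less_mem_kappa: "t \<in> T \<Longrightarrow> s \<in> T \<Longrightarrow> t < s \<Longrightarrow> t \<in> ts_kappa T"
  by (force simp: ts_kappa_def)

text \<open>A point that is removed is isolated from the rest of \<open>T\<close>: the supremum \<open>m\<close> of the points before it
  is smaller.\<close>

lemma kappa_cases:
  obtains "ts_kappa T = T"
  | M m where "M \<in> T" "ts_kappa T = T - {M}" "m < M" "T - {M} \<subseteq> {..m}"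
proof (cases "ts_kappa T = T")
  case False
  then obtain M where M: "M \<in> T" "\<forall>s\<in>T. s \<le> M" "left_scattered T M"
    by (auto simp: ts_kappa_def)
  have "ts_kappa T = T - {M}"
    using M by (auto simp: ts_kappa_def) (meson order_antisym)
  moreover have "T - {M} \<subseteq> {..Sup {s \<in> T. s < M}}"
    using M(2) by (auto intro!: cSup_upper bdd_aboveI[of _ M] simp: less_le)
  ultimately show ?thesis
    using M that(2) by (auto simp: left_scattered_def)
qed (use that(1) in auto)

lemma closed_kappa:
  assumes "closed T" shows "closed (ts_kappa T)"
proof (cases rule: kappa_cases[of T])
  case (2 M m)
  then have "ts_kappa T = T \<inter> {..m}" by auto
  then show ?thesis using assms by auto
qed (use assms in auto)

section \<open>The delta derivative\<close>

lemma has_delta_derivative_iff_delta: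
  "has_delta_derivative T f D t \<longleftrightarrow>
     (\<forall>\<epsilon>>0. \<exists>\<delta>>0. \<forall>s\<in>T. \<bar>s - t\<bar> < \<delta> \<longrightarrow>
        norm (f (ts_sigma T t) - f s - (ts_sigma T t - s) *\<^sub>R D) \<le> \<epsilon> * \<bar>ts_sigma T t - s\<bar>)"
  (is "?L \<longleftrightarrow> ?R")
proof
  assume L: ?L
  show ?R
  proof (intro allI impI)
    fix e :: real assume "0 < e"
    then obtain U where U: "open U" "t \<in> U" "\<forall>s\<in>U \<inter> T. norm (f (ts_sigma T t) - f s - (ts_sigma T t - s) *\<^sub>R D)
                       \<le> e * \<bar>ts_sigma T t - s\<bar>"
      using L unfolding has_delta_derivative_def by blast
    then obtain d where "d > 0" "\<forall>s. dist s t < d \<longrightarrow> s \<in> U"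
      by (auto simp: open_dist)
    then show "\<exists>\<delta>>0. \<forall>s\<in>T. \<bar>s - t\<bar> < \<delta> \<longrightarrow>
        norm (f (ts_sigma T t) - f s - (ts_sigma T t - s) *\<^sub>R D) \<le> e * \<bar>ts_sigma T t - s\<bar>"
      using U(3) by (auto simp: dist_real_def)
  qed
next
  assume R: ?R
  show ?L
    unfolding has_delta_derivative_def
  proof (intro allI impI)
    fix e :: real assume "0 < e"
    then obtain d where d: "d > 0" "\<forall>s\<in>T. \<bar>s - t\<bar> < d \<longrightarrow>
        norm (f (ts_sigma T t) - f s - (ts_sigma T t - s) *\<^sub>R D) \<le> e * \<bar>ts_sigma T t - s\<bar>"
      using R by blast
    show "\<exists>U. open U \<and> t \<in> U \<and> (\<forall>s\<in>U \<inter> T. norm (f (ts_sigma T t) - f s - (ts_sigma T t - s) *\<^sub>R D)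
                       \<le> e * \<bar>ts_sigma T t - s\<bar>)"
      using d by (intro exI[of _ "ball t d"]) (auto simp: dist_real_def abs_minus_commute)
  qed
qed

text \<open>At a right-dense point the delta derivative is the ordinary derivative relative to \<open>T\<close>; at a
  right-scattered point it is a difference quotient, and the limit in the definition only expresses
  continuity. Through these two characterizations the calculus rules reduce to those of ordinary
  analysis.\<close>

lemma has_delta_derivative_dense_iff:
  assumes "ts_sigma T t = t"
  shows "has_delta_derivative T f D t \<longleftrightarrow> (f has_vector_derivative D) (at t within T)"
proof -
  have "norm (f t - f s - (t - s) *\<^sub>R D) = norm (f s - f t - (s - t) *\<^sub>R D)" for s
    by (subst norm_minus_cancel[symmetric]) (simp add: algebra_simps)
  then show ?thesis
    using assms unfolding has_delta_derivative_iff_delta has_vector_derivative_def has_derivative_within_alt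
    by (simp add: bounded_linear_scaleR_left abs_minus_commute)
qed

lemma has_delta_derivative_sigma:
  assumes "has_delta_derivative T f D t" "t \<in> T"
  shows "f (ts_sigma T t) = f t + ts_mu T t *\<^sub>R D"
proof -
  let ?n = "norm (f (ts_sigma T t) - f t - (ts_sigma T t - t) *\<^sub>R D)"
  have "?n \<le> 0 + e" if "e > 0" for e
  proof -
    let ?e = "e / (1 + \<bar>ts_sigma T t - t\<bar>)"
    have "?e > 0" using that by (auto simp: add_pos_nonneg)
    then have "?n \<le> ?e * \<bar>ts_sigma T t - t\<bar>"
      using assms unfolding has_delta_derivative_iff_delta by (metis abs_zero cancel_comm_monoid_add_class.diff_cancel)
    also have "\<dots> \<le> e"
      using that by (simp add: field_simps)
    finally show ?thesis by simp
  qed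
  then have "?n \<le> 0" by (rule field_le_epsilon)
  then show ?thesis by (simp add: ts_mu_def algebra_simps)
qed

lemma has_delta_derivative_scattered_iff:
  assumes "t \<in> T" "t < ts_sigma T t"
  shows "has_delta_derivative T f D t \<longleftrightarrow>
    continuous (at t within T) f \<and> f (ts_sigma T t) = f t + ts_mu T t *\<^sub>R D"
proof (intro iffI conjI)
  let ?s = "ts_sigma T t"
  assume L: "has_delta_derivative T f D t"
  show eq: "f ?s = f t + ts_mu T t *\<^sub>R D"
    by (rule has_delta_derivative_sigma[OF L assms(1)])
  show "continuous (at t within T) f"
    unfolding continuous_within_eps_delta
  proof (intro allI impI)
    fix e :: real assume "e > 0"
    \<comment> \<open>Near \<open>t\<close> the distance from \<open>s\<close> to the jump is at most twice the graininess, so the definition with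
      tolerance \<open>e1\<close> contributes at most \<open>e / 2\<close>; the term \<open>(s - t) *\<^sub>R D\<close> contributes the rest.\<close>
    define e1 where "e1 = e / (4 * ts_mu T t)"
    have m: "ts_mu T t > 0" using assms by (simp add: ts_mu_def)
    have "e1 > 0" using m \<open>e > 0\<close> by (simp add: e1_def)
    then obtain d where d: "d > 0" "\<forall>s\<in>T. \<bar>s - t\<bar> < d \<longrightarrow> norm (f ?s - f s - (?s - s) *\<^sub>R D) \<le> e1 * \<bar>?s - s\<bar>"
      using L unfolding has_delta_derivative_iff_delta by blast
    define d1 where "d1 = min d (min (ts_mu T t) (e / (2 * (1 + norm D))))"
    have "e / (2 * (1 + norm D)) > 0" using \<open>e > 0\<close> by (simp add: add_pos_nonneg)
    then have "d1 > 0" using d m by (auto simp: d1_def)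
    moreover have "dist (f s) (f t) < e" if s: "s \<in> T" "dist s t < d1" for s
    proof -
      have "\<bar>s - t\<bar> < d" "\<bar>s - t\<bar> < ts_mu T t" and sD: "\<bar>s - t\<bar> < e / (2 * (1 + norm D))"
        using s by (auto simp: d1_def dist_real_def)
      then have "norm (f ?s - f s - (?s - s) *\<^sub>R D) \<le> e1 * \<bar>?s - s\<bar>"
        using d s by auto
      also have "\<dots> \<le> e1 * (2 * ts_mu T t)"
        using \<open>\<bar>s - t\<bar> < ts_mu T t\<close> \<open>e1 > 0\<close> by (intro mult_left_mono) (auto simp: ts_mu_def)
      also have "\<dots> = e / 2" using m by (simp add: e1_def)
      finally have *: "norm (f ?s - f s - (?s - s) *\<^sub>R D) \<le> e / 2" .
      have "f s - f t = (s - t) *\<^sub>R D - (f ?s - f s - (?s - s) *\<^sub>R D)"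
        by (simp add: eq ts_mu_def algebra_simps)
      then have "norm (f s - f t) \<le> \<bar>s - t\<bar> * norm D + e / 2"
        using norm_triangle_ineq4[of "(s - t) *\<^sub>R D" "f ?s - f s - (?s - s) *\<^sub>R D"] *
        by (simp only: norm_scaleR real_norm_def)
      also have "\<bar>s - t\<bar> * norm D \<le> \<bar>s - t\<bar> * (1 + norm D)"
        by (simp add: mult_left_mono)
      also have "\<bar>s - t\<bar> * (1 + norm D) < e / 2"
        using sD by (simp add: field_simps add_pos_nonneg)
      finally show ?thesis by (simp add: dist_norm)
    qed
    ultimately show "\<exists>d>0. \<forall>s\<in>T. dist s t < d \<longrightarrow> dist (f s) (f t) < e" by blast
  qed
next
  let ?s = "ts_sigma T t"
  assume R: "continuous (at t within T) f \<and> f ?s = f t + ts_mu T t *\<^sub>R D"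
  have m: "ts_mu T t > 0" using assms by (simp add: ts_mu_def)
  show "has_delta_derivative T f D t"
    unfolding has_delta_derivative_iff_delta
  proof (intro allI impI)
    fix e :: real assume "e > 0"
    let ?g = "\<lambda>s. f t - f s + (s - t) *\<^sub>R D"
    have "continuous (at t within T) ?g"
      using R by (intro continuous_intros) auto
    moreover have "e * ts_mu T t / 2 > 0" using \<open>e > 0\<close> m by simp
    ultimately obtain d where d: "d > 0" "\<forall>s\<in>T. dist s t < d \<longrightarrow> dist (?g s) (?g t) < e * ts_mu T t / 2"
      unfolding continuous_within_eps_delta by blast
    have "norm (f ?s - f s - (?s - s) *\<^sub>R D) \<le> e * \<bar>?s - s\<bar>"
      if s: "s \<in> T" "\<bar>s - t\<bar> < min d (ts_mu T t / 2)" for s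
    proof -
      have "norm (?g s) < e * (ts_mu T t / 2)"
        using s d by (auto simp: dist_norm)
      also have "\<dots> \<le> e * \<bar>?s - s\<bar>"
        using s \<open>e > 0\<close> by (intro mult_left_mono) (auto simp: ts_mu_def abs_if split: if_splits)
      also have "?g s = f ?s - f s - (?s - s) *\<^sub>R D"
        using R by (simp add: ts_mu_def algebra_simps)
      finally show ?thesis by simp
    qed
    then show "\<exists>\<delta>>0. \<forall>s\<in>T. \<bar>s - t\<bar> < \<delta> \<longrightarrow> norm (f ?s - f s - (?s - s) *\<^sub>R D) \<le> e * \<bar>?s - s\<bar>"
      using d m by (intro exI[of _ "min d (ts_mu T t / 2)"]) auto
  qed
qed

lemma has_delta_derivative_iff:
  assumes "closed T" "t \<in> T"
  shows "has_delta_derivative T f D t \<longleftrightarrow>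
    (if ts_sigma T t = t then (f has_vector_derivative D) (at t within T)
     else continuous (at t within T) f \<and> f (ts_sigma T t) = f t + ts_mu T t *\<^sub>R D)"
  using has_delta_derivative_dense_iff[of T t f D] has_delta_derivative_scattered_iff[of t T f D]
    sigma_ge[OF assms] assms by (auto simp: less_le)

lemma has_delta_derivative_continuous:
  assumes "closed T" "t \<in> T" "has_delta_derivative T f D t"
  shows "continuous (at t within T) f"
  using assms has_vector_derivative_continuous
  by (auto simp: has_delta_derivative_iff split: if_splits)

lemma has_delta_derivative_bounded_linear:
  assumes "bounded_linear L" "closed T" "t \<in> T" "has_delta_derivative T f D t"
  shows "has_delta_derivative T (\<lambda>s. L (f s)) (L D) t"
proof -
  interpret L: bounded_linear L by fact
  show ?thesis
    using assms L.has_vector_derivative L.continuous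
    by (auto simp: has_delta_derivative_iff L.add L.scaleR split: if_splits)
qed

lemma has_delta_derivative_add:
  assumes "closed T" "t \<in> T" "has_delta_derivative T f D t" "has_delta_derivative T g E t"
  shows "has_delta_derivative T (\<lambda>s. f s + g s) (D + E) t"
  using assms
  by (auto simp: has_delta_derivative_iff algebra_simps split: if_splits
      intro: has_vector_derivative_add continuous_add)

lemma has_delta_derivative_mult:
  fixes c :: "'a::real_normed_field"
  assumes "closed T" "t \<in> T" "has_delta_derivative T f D t"
  shows "has_delta_derivative T (\<lambda>s. c * f s) (c * D) t"
  using has_delta_derivative_bounded_linear[OF bounded_linear_mult_right assms] .

lemma has_delta_derivative_diff:
  assumes "closed T" "t \<in> T" "has_delta_derivative T f D t" "has_delta_derivative T g E t"
  shows "has_delta_derivative T (\<lambda>s. f s - g s) (D - E) t"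
  using has_delta_derivative_add[OF assms(1-3)
    has_delta_derivative_bounded_linear[OF bounded_linear_minus[OF bounded_linear_ident] assms(1,2,4)]]
  by simp

lemma has_delta_derivative_const: "has_delta_derivative T (\<lambda>s. c) 0 t"
  by (auto simp: has_delta_derivative_iff_delta intro: exI[of _ 1])

lemma has_delta_derivative_cong:
  assumes "closed T" "t \<in> T" "\<And>s. s \<in> T \<Longrightarrow> f s = g s"
  shows "has_delta_derivative T f D t \<longleftrightarrow> has_delta_derivative T g D t"
  using assms sigma_mem[OF assms(1,2)] unfolding has_delta_derivative_iff_delta by simp

text \<open>If \<open>T\<close> has a second point, then every \<open>t\<close> in \<open>ts_kappa T\<close> is either right-scattered, where the
  derivative is a difference quotient, or a limit point of \<open>T\<close>: it is approached from the right, or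
  it is a maximum that is not left-scattered. On a one-point time scale every value would be a
  derivative.\<close>

lemma has_delta_derivative_unique:
  assumes "closed T" "t \<in> ts_kappa T" "s0 \<in> T" "s0 \<noteq> t"
    and "has_delta_derivative T f D t" "has_delta_derivative T f E t"
  shows "D = E"
proof (cases "ts_sigma T t = t")
  case False
  then show ?thesis
    using assms kappa_subset[of T] has_delta_derivative_sigma[of T f D t] has_delta_derivative_sigma[of T f E t]
    by (auto simp: ts_mu_def)
next
  case True
  have tT: "t \<in> T" using assms(2) kappa_subset by auto
  have "at t within T \<noteq> bot"
    unfolding trivial_limit_within islimpt_approachable not_not
  proof (intro allI impI)
    fix e :: real assume "e > 0"
    show "\<exists>x'\<in>T. x' \<noteq> t \<and> dist x' t < e"
    proof (cases "\<exists>s\<in>T. t < s")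
      case True
      then obtain s u where "u \<in> T" "t < u" "u < t + e"
        using right_dense_points[OF \<open>ts_sigma T t = t\<close>, of _ "t + e"] \<open>e > 0\<close> by auto
      then show ?thesis by (intro bexI[of _ u]) (auto simp: dist_real_def)
    next
      case False
      then have "\<not> left_scattered T t" "s0 < t"
        using assms(2-4) by (auto simp: ts_kappa_def not_less less_le)
      then have "t - e < Sup {s \<in> T. s < t}"
        using assms(3) \<open>e > 0\<close> by (auto simp: left_scattered_def)
      then obtain u where "u \<in> T" "u < t" "t - e < u"
        using \<open>s0 < t\<close> assms(3) by (subst (asm) less_cSup_iff) (auto intro!: bdd_aboveI[of _ t])
      then show ?thesis by (intro bexI[of _ u]) (auto simp: dist_real_def)
    qed
  qed
  then show ?thesis
    using assms(5,6) vector_derivative_unique_within by (auto simp: has_delta_derivative_dense_iff[OF True])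
qed

text \<open>The only point outside \<open>ts_kappa T\<close> is isolated, so continuity there is free.\<close>

lemma continuous_on_of_has_delta_derivative:
  assumes "closed T" "\<And>t. t \<in> ts_kappa T \<Longrightarrow> has_delta_derivative T F (f t) t"
  shows "continuous_on T F"
  unfolding continuous_on_eq_continuous_within
proof
  fix t assume "t \<in> T"
  show "continuous (at t within T) F"
  proof (cases "t \<in> ts_kappa T")
    case True
    then show ?thesis using assms \<open>t \<in> T\<close> has_delta_derivative_continuous by blast
  next
    case False
    then obtain m where "m < t" "T - {t} \<subseteq> {..m}"
      using \<open>t \<in> T\<close> by (cases rule: kappa_cases[of T]) auto
    then have "\<forall>s\<in>T. dist s t < t - m \<longrightarrow> s = t"
      by (auto simp: dist_real_def abs_if split: if_splits)
    then show ?thesis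
      unfolding continuous_within_eps_delta using \<open>m < t\<close>
      by (intro allI impI exI[of _ "t - m"]) auto
  qed
qed

section \<open>The mean value inequality\<close>

text \<open>The points at which the estimate holds, with a slightly larger constant, form a closed set. Its
  supremum is \<open>d\<close>, since from any earlier point the estimate passes on: over a gap because the
  increment is exactly the graininess times the derivative, and at a right-dense point because the
  derivative controls the increment nearby.\<close>

lemma delta_mean_value_inequality:
  fixes F :: "real \<Rightarrow> 'a::real_normed_vector"
  assumes "closed T" "c \<in> T" "d \<in> T" "c \<le> d" "continuous_on T F"
    and der: "\<And>t. t \<in> T \<Longrightarrow> c \<le> t \<Longrightarrow> t < d \<Longrightarrow> has_delta_derivative T F (f t) t"
    and bound: "\<And>t. t \<in> T \<Longrightarrow> c \<le> t \<Longrightarrow> t < d \<Longrightarrow> norm (f t) \<le> B"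
  shows "norm (F d - F c) \<le> B * (d - c)"
proof -
  have main: "norm (F d - F c) \<le> (B + e) * (d - c)" if "e > 0" for e
  proof -
    let ?C = "B + e"
    define S where "S = {t \<in> T \<inter> {c..d}. norm (F t - F c) \<le> ?C * (t - c)}"
    have "closed S"
      unfolding S_def using assms(1,5)
      by (intro continuous_closed_preimage_constant continuous_on_closed_Collect_le continuous_intros closed_Int)
        (auto intro: continuous_on_subset)
    moreover have "c \<in> S" using assms by (auto simp: S_def)
    moreover have bS: "bdd_above S" by (auto simp: S_def intro: bdd_aboveI[of _ d])
    ultimately have mS: "Sup S \<in> S" by (intro closed_contains_Sup) auto
    define m where "m = Sup S"
    have m: "m \<in> T" "c \<le> m" "m \<le> d" "norm (F m - F c) \<le> ?C * (m - c)"
      using mS by (auto simp: S_def m_def)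
    \<comment> \<open>The estimate may be continued from \<open>m\<close>; by maximality of \<open>m\<close> it cannot reach a later point.\<close>
    have step: "u \<le> m" if u: "u \<in> T" "m \<le> u" "u \<le> d" "norm (F u - F m) \<le> ?C * (u - m)" for u
    proof -
      have "norm (F u - F c) \<le> norm (F u - F m) + norm (F m - F c)"
        using norm_triangle_ineq[of "F u - F m" "F m - F c"] by simp
      then have "norm (F u - F c) \<le> ?C * (u - c)"
        using u m by (simp add: algebra_simps)
      then have "u \<in> S" using u m by (auto simp: S_def)
      then show "u \<le> m" unfolding m_def by (rule cSup_upper[OF _ bS])
    qed
    have "m = d"
    proof (rule ccontr)
      assume "m \<noteq> d"
      then have "m < d" using m by simp
      note D = der[OF m(1,2) this] and bd = bound[OF m(1,2) this]
      show False
      proof (cases "ts_sigma T m = m")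
        case False
        then have "m < ts_sigma T m" using sigma_ge[OF assms(1) m(1)] by simp
        have "norm (F (ts_sigma T m) - F m) = ts_mu T m * norm (f m)"
          using has_delta_derivative_sigma[OF D m(1)] mu_nonneg[OF assms(1) m(1)] by simp
        also have "\<dots> \<le> ts_mu T m * ?C"
          using bd \<open>e > 0\<close> mu_nonneg[OF assms(1) m(1)] by (intro mult_left_mono) auto
        finally have "ts_sigma T m \<le> m"
          using sigma_mem[OF assms(1) m(1)] sigma_le[OF assms(3) \<open>m < d\<close>] sigma_ge[OF assms(1) m(1)]
          by (intro step) (auto simp: ts_mu_def mult.commute)
        then show False using \<open>m < ts_sigma T m\<close> by simp
      next
        case True
        obtain \<delta> where \<delta>: "\<delta> > 0" "\<forall>s\<in>T. \<bar>s - m\<bar> < \<delta> \<longrightarrow> norm (F m - F s - (m - s) *\<^sub>R f m) \<le> e * \<bar>m - s\<bar>"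
          using D \<open>e > 0\<close> unfolding has_delta_derivative_iff_delta True by blast
        obtain u where u: "u \<in> T" "m < u" "u < min (m + \<delta>) d"
          using right_dense_points[OF True assms(3) \<open>m < d\<close>, of "min (m + \<delta>) d"] \<delta> \<open>m < d\<close> by auto
        have "norm (F u - F m) \<le> norm (F m - F u - (m - u) *\<^sub>R f m) + norm ((m - u) *\<^sub>R f m)"
          using norm_triangle_ineq[of "F m - F u - (m - u) *\<^sub>R f m" "(m - u) *\<^sub>R f m"]
          by (simp add: norm_minus_commute)
        also have "\<dots> \<le> e * (u - m) + (u - m) * B"
          using \<delta> u bd by (intro add_mono) (auto simp: intro!: mult_left_mono)
        finally have "u \<le> m" using u by (intro step) (auto simp: algebra_simps)
        then show False using u by simp
      qed
    qed
    then show ?thesis using m by simp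
  qed
  show ?thesis
  proof (rule field_le_epsilon)
    fix e :: real assume "e > 0"
    have "norm (F d - F c) \<le> (B + e / (1 + (d - c))) * (d - c)"
      using \<open>e > 0\<close> assms(4) by (intro main) auto
    also have "\<dots> \<le> B * (d - c) + e"
      using \<open>e > 0\<close> assms(4) by (simp add: field_simps)
    finally show "norm (F d - F c) \<le> B * (d - c) + e" .
  qed
qed

lemma zero_delta_derivative_imp_constant:
  assumes "closed T" "s \<in> T" "t \<in> T"
    and "\<And>u. u \<in> ts_kappa T \<Longrightarrow> has_delta_derivative T F 0 u"
  shows "F s = F t"
proof -
  have "F s = F t" if "s \<in> T" "t \<in> T" "s \<le> t" for s t
    using delta_mean_value_inequality[OF assms(1) that, of F "\<lambda>_. 0" 0]
      continuous_on_of_has_delta_derivative[OF assms(1,4)] assms(4) less_mem_kappa[OF _ that(2)]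
    by auto
  then show ?thesis using assms(2,3) by (metis linear)
qed

section \<open>Antiderivatives\<close>

text \<open>Composition with this retraction onto \<open>T\<close> makes a function constant on the gaps of \<open>T\<close>, so that the delta integral becomes an ordinary integral over the reals. The value \<open>Inf T\<close>
  to the left of \<open>T\<close> keeps the function monotone with values in \<open>T\<close> on the whole line.\<close>

definition ts_floor :: "real set \<Rightarrow> real \<Rightarrow> real" where
  "ts_floor T u = (if \<exists>t\<in>T. t \<le> u then Sup {t \<in> T. t \<le> u} else Inf T)"

lemma ts_floor_props:
  assumes "closed T" "T \<noteq> {}"
  shows ts_floor_mem: "ts_floor T u \<in> T"
    and ts_floor_le: "t \<in> T \<Longrightarrow> t \<le> u \<Longrightarrow> ts_floor T u \<le> u"
    and ts_floor_ge: "t \<in> T \<Longrightarrow> t \<le> u \<Longrightarrow> t \<le> ts_floor T u"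
proof -
  have "ts_floor T u \<in> T \<and> ((\<exists>t\<in>T. t \<le> u) \<longrightarrow> ts_floor T u \<le> u) \<and> (\<forall>t\<in>T. t \<le> u \<longrightarrow> t \<le> ts_floor T u)"
  proof (cases "\<exists>t\<in>T. t \<le> u")
    case True
    have eq: "{t \<in> T. t \<le> u} = T \<inter> {..u}" by auto
    have bd: "bdd_above {t \<in> T. t \<le> u}" by (auto intro: bdd_aboveI[of _ u])
    have "Sup {t \<in> T. t \<le> u} \<in> {t \<in> T. t \<le> u}"
      using True assms bd by (intro closed_contains_Sup) (auto simp: eq)
    then show ?thesis
      using True bd by (auto simp: ts_floor_def intro!: cSup_upper)
  next
    case False
    then have "bdd_below T" by (intro bdd_belowI[of _ u]) (meson linear)
    then show ?thesis
      using False assms closed_contains_Inf[of T] by (auto simp: ts_floor_def)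
  qed
  then show "ts_floor T u \<in> T" "t \<in> T \<Longrightarrow> t \<le> u \<Longrightarrow> ts_floor T u \<le> u"
    "t \<in> T \<Longrightarrow> t \<le> u \<Longrightarrow> t \<le> ts_floor T u"
    by blast+
qed

lemma mono_ts_floor:
  assumes "closed T" "T \<noteq> {}" shows "mono (ts_floor T)"
proof (rule monoI)
  fix u v :: real assume uv: "u \<le> v"
  show "ts_floor T u \<le> ts_floor T v"
  proof (cases "\<exists>t\<in>T. t \<le> u")
    case True
    then show ?thesis
      using ts_floor_ge[OF assms ts_floor_mem[OF assms], of u v] ts_floor_le[OF assms] uv by force
  next
    case False
    then have "bdd_below T" by (intro bdd_belowI[of _ u]) (meson linear)
    then show ?thesis
      using False cInf_lower[OF ts_floor_mem[OF assms]] by (auto simp: ts_floor_def[of T u])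
  qed
qed

lemma ts_floor_gap:
  assumes "closed T" "t \<in> T" "t \<le> u" "u < ts_sigma T t"
  shows "ts_floor T u = t"
proof -
  have ne: "T \<noteq> {}" using assms by auto
  have "ts_floor T u \<le> t"
    using sigma_le[OF ts_floor_mem[OF assms(1) ne], of t u] ts_floor_le[OF assms(1) ne assms(2,3)] assms(4)
    by force
  then show ?thesis using ts_floor_ge[OF assms(1) ne assms(2,3)] by simp
qed

lemma borel_measurable_ts_floor:
  assumes "closed T" "T \<noteq> {}" shows "ts_floor T \<in> borel_measurable borel"
  by (rule borel_measurable_mono[OF mono_ts_floor[OF assms]])

lemma integrable_on_bounded_borel:
  fixes g :: "real \<Rightarrow> 'a::euclidean_space"
  assumes "g \<in> borel_measurable borel" "\<And>u. u \<in> {c..d} \<Longrightarrow> norm (g u) \<le> B"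
  shows "g integrable_on {c..d}"
proof (rule measurable_bounded_by_integrable_imp_integrable)
  show "g \<in> borel_measurable (lebesgue_on {c..d})"
    using assms(1) by (intro measurable_restrict_space1 measurable_completion) simp
  show "(\<lambda>_. B) integrable_on {c..d}" by (rule integrable_const_ivl)
qed (use assms in auto)

text \<open>Integrals from a base point have to be taken with a sign, as \<open>integral {c..d}\<close> vanishes for \<open>d < c\<close>.\<close>

lemma locally_integrable_has_primitive:
  fixes g :: "real \<Rightarrow> 'a::banach"
  assumes "\<And>c d. g integrable_on {c..d}"
  obtains F where "continuous_on UNIV F" "\<And>c d. c \<le> d \<Longrightarrow> (g has_integral F d - F c) {c..d}"
proof -
  define F where "F t = (if 0 \<le> t then integral {0..t} g else - integral {t..0} g)" for t
  have comb: "integral {c..b} g + integral {b..d} g = integral {c..d} g" if "c \<le> b" "b \<le> d" for b c d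
    by (rule Henstock_Kurzweil_Integration.integral_combine[OF that assms])
  have int: "integral {c..d} g = F d - F c" if "c \<le> d" for c d
    using that comb[of 0 c d] comb[of c 0 d] comb[of c d 0] by (auto simp: F_def algebra_simps)
  show thesis
  proof (rule that)
    show "(g has_integral F d - F c) {c..d}" if "c \<le> d" for c d
      using int[OF that] assms by (metis has_integral_integral)
    show "continuous_on UNIV F"
    proof (rule continuous_at_imp_continuous_on, intro ballI)
      fix t :: real
      have "continuous_on {t-1..t+1} (\<lambda>x. F (t - 1) + integral {t-1..x} g)"
        by (intro continuous_intros indefinite_integral_continuous_1 assms)
      then have "continuous_on {t-1..t+1} F"
        by (rule continuous_on_eq) (auto simp: int)
      then show "isCont F t"
        by (rule continuous_on_interior) (simp add: interior_atLeastAtMost_real)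
    qed
  qed
qed

text \<open>The primitive of the step extension \<open>f \<circ> ts_floor T\<close> is a delta antiderivative. Over a gap starting
  at \<open>t\<close> the extension is constantly \<open>f t\<close>, which gives the difference quotient; at a right-dense
  point, continuity of \<open>f\<close> bounds the integrand. Continuity at right-dense points is what holds for
  the logarithmic integrand that produces the exponential, which may jump at a point that is
  left-dense and right-scattered.\<close>

lemma delta_antiderivative:
  fixes f :: "real \<Rightarrow> 'a::euclidean_space"
  assumes T: "closed T" "T \<noteq> {}"
    and int: "\<And>c d. (\<lambda>u. f (ts_floor T u)) integrable_on {c..d}"
    and cont: "\<And>t. t \<in> T \<Longrightarrow> ts_sigma T t = t \<Longrightarrow> continuous (at t within T) f"
  obtains F where "\<And>t. t \<in> T \<Longrightarrow> has_delta_derivative T F (f t) t"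
proof -
  let ?g = "\<lambda>u. f (ts_floor T u)"
  obtain F where F: "continuous_on UNIV F" "\<And>c d. c \<le> d \<Longrightarrow> (?g has_integral F d - F c) {c..d}"
    using locally_integrable_has_primitive[OF int] by blast
  have "has_delta_derivative T F (f t) t" if t: "t \<in> T" for t
  proof (cases "ts_sigma T t = t")
    case False
    then have less: "t < ts_sigma T t" using sigma_ge[OF T(1) t] by simp
    have "(?g has_integral ts_mu T t *\<^sub>R f t) {t..ts_sigma T t}"
    proof (rule has_integral_spike_finite[where S = "{ts_sigma T t}"])
      show "((\<lambda>u. f t) has_integral ts_mu T t *\<^sub>R f t) {t..ts_sigma T t}"
        using has_integral_const_real[of "f t" t "ts_sigma T t"] less by (simp add: ts_mu_def)
      show "?g u = f t" if "u \<in> {t..ts_sigma T t} - {ts_sigma T t}" for u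
        using that ts_floor_gap[OF T(1) t, of u] by auto
    qed auto
    then have "F (ts_sigma T t) - F t = ts_mu T t *\<^sub>R f t"
      using F(2) less has_integral_unique by (metis less_imp_le)
    moreover have "continuous (at t within T) F"
      using F(1) continuous_on_eq_continuous_at continuous_at_imp_continuous_at_within by blast
    ultimately show ?thesis
      using False by (simp add: has_delta_derivative_iff[OF T(1) t] algebra_simps)
  next
    case True
    show ?thesis
      unfolding has_delta_derivative_iff_delta True
    proof (intro allI impI)
      fix e :: real assume e: "e > 0"
      then obtain \<delta> where \<delta>: "\<delta> > 0" "\<forall>s\<in>T. dist s t < \<delta> \<longrightarrow> dist (f s) (f t) < e"
        using cont[OF t True] unfolding continuous_within_eps_delta by blast
      \<comment> \<open>The left end \<open>c\<close> must lie in \<open>T\<close>, so that \<open>ts_floor T\<close> does not leave \<open>{c..d}\<close>.\<close>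
      have main: "norm (F d - F c - (d - c) *\<^sub>R f t) \<le> e * (d - c)"
        if cd: "c \<in> T" "c \<le> d" "t - \<delta> < c" "d < t + \<delta>" for c d
      proof -
        have "((\<lambda>u. ?g u - f t) has_integral (F d - F c - (d - c) *\<^sub>R f t)) (cbox c d)"
          using has_integral_diff[OF F(2)[OF cd(2)] has_integral_const_real[of "f t" c d]] cd by simp
        moreover have "norm (?g u - f t) \<le> e" if "u \<in> cbox c d" for u
        proof -
          have "ts_floor T u \<in> T" "c \<le> ts_floor T u" "ts_floor T u \<le> d"
            using that cd ts_floor_mem[OF T] ts_floor_ge[OF T cd(1), of u] ts_floor_le[OF T cd(1), of u]
            by auto
          then have "dist (ts_floor T u) t < \<delta>" using cd by (auto simp: dist_real_def)
          then show ?thesis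
            using \<delta> ts_floor_mem[OF T, of u] by (auto simp: dist_norm less_imp_le)
        qed
        ultimately show ?thesis
          using has_integral_bound[of e "\<lambda>u. ?g u - f t" _ c d] e cd by simp
      qed
      show "\<exists>\<delta>>0. \<forall>s\<in>T. \<bar>s - t\<bar> < \<delta> \<longrightarrow> norm (F t - F s - (t - s) *\<^sub>R f t) \<le> e * \<bar>t - s\<bar>"
      proof (intro exI conjI ballI impI)
        show "0 < \<delta>" by fact
        fix s assume s: "s \<in> T" "\<bar>s - t\<bar> < \<delta>"
        show "norm (F t - F s - (t - s) *\<^sub>R f t) \<le> e * \<bar>t - s\<bar>"
        proof (cases "s \<le> t")
          case True
          then show ?thesis using main[of s t] s \<open>\<delta> > 0\<close> by auto
        next
          case False
          moreover have "F t - F s - (t - s) *\<^sub>R f t = - (F s - F t - (s - t) *\<^sub>R f t)"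
            by (simp add: algebra_simps)
          ultimately show ?thesis using main[of t s] t s \<open>\<delta> > 0\<close>
            by (simp only: norm_minus_cancel) auto
        qed
      qed
    qed
  qed
  then show thesis by (rule that)
qed

lemma delta_antiderivative_continuous:
  fixes f :: "real \<Rightarrow> 'a::euclidean_space"
  assumes T: "closed T" "T \<noteq> {}" and f: "continuous_on T f"
  obtains F where "\<And>t. t \<in> T \<Longrightarrow> has_delta_derivative T F (f t) t"
proof (rule delta_antiderivative[OF T, of f])
  show "continuous (at t within T) f" if "t \<in> T" for t
    using f that by (auto simp: continuous_on_eq_continuous_within)
  fix c d
  \<comment> \<open>A continuous extension of \<open>f\<close> makes Borel measurability and local boundedness of the step
    extension immediate.\<close>
  obtain g where g: "continuous_on UNIV g" "\<And>x. x \<in> T \<Longrightarrow> g x = f x"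
    using Tietze_unbounded[OF f, of UNIV] T by auto
  have eq: "(\<lambda>u. f (ts_floor T u)) = g \<circ> ts_floor T"
    using g(2)[OF ts_floor_mem[OF T]] by auto
  have "g \<circ> ts_floor T \<in> borel_measurable borel"
    by (rule measurable_comp[OF borel_measurable_ts_floor[OF T] borel_measurable_continuous_onI[OF g(1)]])
  moreover have "bounded (g ` {ts_floor T c..ts_floor T d})"
    by (intro compact_imp_bounded compact_continuous_image continuous_on_subset[OF g(1)]) auto
  then obtain B where "\<And>x. x \<in> {ts_floor T c..ts_floor T d} \<Longrightarrow> norm (g x) \<le> B"
    unfolding bounded_iff by blast
  then have "norm ((g \<circ> ts_floor T) u) \<le> B" if "u \<in> {c..d}" for u
    using that monoD[OF mono_ts_floor[OF T]] by auto
  ultimately show "(\<lambda>u. f (ts_floor T u)) integrable_on {c..d}"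
    unfolding eq by (rule integrable_on_bounded_borel)
qed (rule that; blast)

section \<open>Time scale polynomials\<close>

text \<open>One induction gives both facts: continuity of each polynomial provides an antiderivative, and as
  antiderivatives are unique up to a constant this is the next polynomial, again continuous.\<close>

lemma
  assumes "closed T" "a \<in> T"
  shows ts_poly_continuous: "continuous_on T (\<lambda>t. ts_poly T j t a)"
    and ts_poly_Suc_has_delta_derivative: "t \<in> ts_kappa T \<Longrightarrow>
      has_delta_derivative T (\<lambda>t. ts_poly T (Suc j) t a) (ts_poly T j t a) t"
proof -
  have step: "\<forall>t\<in>ts_kappa T. has_delta_derivative T (\<lambda>t. ts_poly T (Suc j) t a) (ts_poly T j t a) t"
    if cont: "continuous_on T (\<lambda>t. ts_poly T j t a)" for j
  proof -
    obtain F where F: "\<And>t. t \<in> T \<Longrightarrow> has_delta_derivative T F (ts_poly T j t a) t"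
      using delta_antiderivative_continuous[OF assms(1) _ cont] assms(2) by blast
    have "delta_integral T (\<lambda>\<tau>. ts_poly T j \<tau> a) a t = F t - F a" if "t \<in> T" for t
      unfolding delta_integral_def
    proof (rule the_equality)
      show "\<exists>G. (\<forall>\<tau>\<in>ts_kappa T. has_delta_derivative T G (ts_poly T j \<tau> a) \<tau>) \<and> F t - F a = G t - G a"
        using F kappa_subset[of T] by blast
      fix I assume "\<exists>G. (\<forall>\<tau>\<in>ts_kappa T. has_delta_derivative T G (ts_poly T j \<tau> a) \<tau>) \<and> I = G t - G a"
      then obtain G where G: "\<And>\<tau>. \<tau> \<in> ts_kappa T \<Longrightarrow> has_delta_derivative T G (ts_poly T j \<tau> a) \<tau>"
        and I: "I = G t - G a" by blast
      have "G t - F t = G a - F a"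
        using has_delta_derivative_diff[OF assms(1) _ G F] kappa_subset[of T]
        by (intro zero_delta_derivative_imp_constant[OF assms(1) that assms(2)]) fastforce
      then show "I = F t - F a" using I by simp
    qed
    moreover have "has_delta_derivative T (\<lambda>t. F t - F a) (ts_poly T j t a) t" if "t \<in> T" for t
      using has_delta_derivative_diff[OF assms(1) that F[OF that] has_delta_derivative_const] by simp
    ultimately show ?thesis
      using has_delta_derivative_cong[OF assms(1), of _ "\<lambda>t. ts_poly T (Suc j) t a" "\<lambda>t. F t - F a"] kappa_subset[of T]
      by auto
  qed
  have cont: "continuous_on T (\<lambda>t. ts_poly T j t a)" for j
  proof (induction j)
    case (Suc j)
    show ?case
      by (rule continuous_on_of_has_delta_derivative[OF assms(1)]) (use step[OF Suc] in blast)
  qed simp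
  show "continuous_on T (\<lambda>t. ts_poly T j t a)" by (rule cont)
  show "has_delta_derivative T (\<lambda>t. ts_poly T (Suc j) t a) (ts_poly T j t a) t" if "t \<in> ts_kappa T"
    using step[OF cont] that by blast
qed

section \<open>The exponential function\<close>

text \<open>The graininess is continuous at right-dense points: to the left of \<open>t\<close> no gap extends beyond \<open>t\<close>,
  and to the right of \<open>t\<close> no gap extends beyond a point \<open>v\<close> of \<open>T\<close> chosen close to \<open>t\<close>.\<close>

lemma mu_small_near_right_dense:
  assumes "t \<in> T" "ts_sigma T t = t" "e > 0"
  obtains d where "d > 0" "\<And>u. u \<in> T \<Longrightarrow> \<bar>u - t\<bar> < d \<Longrightarrow> ts_mu T u < e"
proof -
  have left: "ts_mu T u < e" if "u \<in> T" "u < t" "\<bar>u - t\<bar> < e" for u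
    using sigma_le[OF assms(1) that(2)] that by (auto simp: ts_mu_def)
  show thesis
  proof (cases "\<exists>s\<in>T. t < s")
    case True
    then obtain v where v: "v \<in> T" "t < v" "v < t + e"
      using right_dense_points[OF assms(2), of _ "t + e"] assms(3) by auto
    have "ts_mu T u < e" if u: "u \<in> T" "\<bar>u - t\<bar> < v - t" for u
    proof (cases "u < t")
      case True
      then show ?thesis using left[OF u(1)] u v by auto
    next
      case False
      then have "ts_sigma T u \<le> v" using u by (intro sigma_le v) auto
      then show ?thesis using False v by (auto simp: ts_mu_def)
    qed
    then show ?thesis using that[of "v - t"] v by auto
  next
    case False
    have "ts_mu T u < e" if u: "u \<in> T" "\<bar>u - t\<bar> < e" for u
    proof (cases "u = t")
      case True
      then show ?thesis using assms by (simp add: ts_mu_def)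
    next
      case neq: False
      then have "u < t" using False u(1) by force
      then show ?thesis using left u by auto
    qed
    then show ?thesis using that[of e] assms(3) by auto
  qed
qed

text \<open>Left ends of gaps of length at least \<open>\<delta>\<close> are \<open>\<delta>\<close> apart, so they fall into different cells of the
  grid of width \<open>\<delta>\<close>.\<close>

lemma finite_large_gaps:
  assumes "0 < \<delta>"
  shows "finite {t \<in> T. p \<le> t \<and> t \<le> q \<and> \<delta> \<le> ts_mu T t}" (is "finite ?A")
proof (rule inj_on_finite)
  have step: "\<lfloor>s / \<delta>\<rfloor> < \<lfloor>t / \<delta>\<rfloor>" if "s \<in> ?A" "t \<in> ?A" "s < t" for s t
  proof -
    have "s + \<delta> \<le> t" using sigma_le[of t T s] that by (auto simp: ts_mu_def)
    then have "(s + \<delta>) / \<delta> \<le> t / \<delta>" using assms by (intro divide_right_mono) auto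
    then have "s / \<delta> + 1 \<le> t / \<delta>" using assms by (simp add: add_divide_distrib)
    then show ?thesis by linarith
  qed
  show "inj_on (\<lambda>t. \<lfloor>t / \<delta>\<rfloor>) ?A"
    using step by (intro linorder_inj_onI) (auto, metis less_irrefl)
  show "(\<lambda>t. \<lfloor>t / \<delta>\<rfloor>) ` ?A \<subseteq> {\<lfloor>p / \<delta>\<rfloor>..\<lfloor>q / \<delta>\<rfloor>}"
    using assms by (auto intro!: floor_mono divide_right_mono)
qed auto

text \<open>The principal logarithm is continuous on the slit plane, and also on the slit without \<open>0\<close>,
  where it is the logarithm of the modulus shifted by \<open>\<i> * pi\<close>.\<close>

lemma borel_measurable_Ln: "Ln \<in> borel_measurable borel"
proof (rule measurable_piecewise_restrict[of "{- \<real>\<^sub>\<le>\<^sub>0, \<real>\<^sub>\<le>\<^sub>0 - {0}, {0}}"])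
  fix S :: "complex set" assume "S \<in> {- \<real>\<^sub>\<le>\<^sub>0, \<real>\<^sub>\<le>\<^sub>0 - {0}, {0}}"
  then consider "S = - \<real>\<^sub>\<le>\<^sub>0" | "S = \<real>\<^sub>\<le>\<^sub>0 - {0}" | "S = {0}" by auto
  then have "continuous_on S Ln"
  proof cases
    case 2
    have "continuous_on S (\<lambda>z. Ln (- z) + \<i> * pi)"
      using 2 by (intro continuous_intros) (auto simp: complex_nonpos_Reals_iff complex_eq_iff)
    moreover have "Ln z = Ln (- z) + \<i> * pi" if "z \<in> S" for z
      using that 2 Ln_minus[of "- z"] by (auto simp: complex_nonpos_Reals_iff complex_eq_iff)
    ultimately show ?thesis by (metis (no_types, lifting) continuous_on_cong)
  qed (auto intro: continuous_on_Ln)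
  then show "Ln \<in> borel_measurable (restrict_space borel S)"
    by (rule borel_measurable_continuous_on_restrict)
next
  fix S :: "complex set" assume "S \<in> {- \<real>\<^sub>\<le>\<^sub>0, \<real>\<^sub>\<le>\<^sub>0 - {0}, {0}}"
  then show "S \<inter> space borel \<in> sets borel"
    using borel_closed[OF closed_nonpos_Reals_complex] by auto
qed auto

text \<open>Hilger's cylinder transformation: the constant rate of exponential growth over a gap of length \<open>m\<close>
  that multiplies a solution of \<open>y\<^sup>\<Delta> = l y\<close> by \<open>1 + m l\<close>, with its limit \<open>l\<close> for \<open>m = 0\<close>.\<close>

definition cylinder :: "complex \<Rightarrow> real \<Rightarrow> complex" where
  "cylinder l m = (if m = 0 then l else Ln (1 + of_real m * l) / of_real m)"

lemma exp_cylinder: "1 + of_real m * l \<noteq> 0 \<Longrightarrow> exp (of_real m * cylinder l m) = 1 + of_real m * l"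
  by (auto simp: cylinder_def)

lemma cylinder_tendsto:
  assumes "e > 0"
  obtains d where "d > 0" "\<And>m. \<bar>m\<bar> < d \<Longrightarrow> dist (cylinder l m) l < e"
proof -
  have "((\<lambda>z. Ln (1 + z * l)) has_field_derivative l) (at 0)"
    by (auto intro!: derivative_eq_intros simp: complex_nonpos_Reals_iff)
  then have "((\<lambda>h. Ln (1 + h * l) / h) \<longlongrightarrow> l) (at 0)"
    by (simp add: DERIV_def)
  then obtain d where d: "d > 0" "\<forall>h. h \<noteq> 0 \<and> dist h 0 < d \<longrightarrow> dist (Ln (1 + h * l) / h) l < e"
    using assms unfolding LIM_def by auto
  show thesis
  proof (rule that[OF d(1)])
    fix m :: real assume "\<bar>m\<bar> < d"
    then show "dist (cylinder l m) l < e"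
      using d(2)[rule_format, of "of_real m"] assms by (auto simp: cylinder_def)
  qed
qed

lemma cylinder_bound:
  assumes "\<bar>m\<bar> < 1 / (2 * (norm l + 1))"
  shows "norm (cylinder l m) \<le> 2 * norm l"
proof (cases "m = 0")
  case False
  have "\<bar>m\<bar> * norm l \<le> \<bar>m\<bar> * (norm l + 1)" by (intro mult_left_mono) auto
  also have "\<dots> < 1 / 2" using assms by (simp add: field_simps add_pos_nonneg)
  finally have "norm (Ln (1 + of_real m * l)) \<le> 2 * norm (of_real m * l)"
    by (intro norm_Ln_le) (simp add: norm_mult)
  then show ?thesis using False by (simp add: cylinder_def norm_divide norm_mult field_simps)
qed (simp add: cylinder_def)

text \<open>The rate may be large over long gaps, where \<open>1 + m l\<close> may be close to zero or the argument of the
  logarithm may be far from \<open>1\<close>. In a bounded range there are only finitely many such gaps, and over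
  all shorter ones the rate is at most twice \<open>norm l\<close>.\<close>

lemma cylinder_integrable:
  assumes T: "closed T" "T \<noteq> {}"
  shows "(\<lambda>u. cylinder l (ts_mu T (ts_floor T u))) integrable_on {c..d}"
proof -
  let ?\<mu> = "\<lambda>u. ts_mu T (ts_floor T u)"
  have "mono (\<lambda>u. ts_sigma T (ts_floor T u))"
  proof (rule monoI)
    fix u v :: real assume "u \<le> v"
    then have "ts_floor T u \<le> ts_floor T v" by (rule monoD[OF mono_ts_floor[OF T]])
    then show "ts_sigma T (ts_floor T u) \<le> ts_sigma T (ts_floor T v)"
      using sigma_le[OF ts_floor_mem[OF T], of "ts_floor T u" v] sigma_ge[OF T(1) ts_floor_mem[OF T], of v]
      by (cases "ts_floor T u = ts_floor T v") auto
  qed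
  from borel_measurable_mono[OF this] borel_measurable_ts_floor[OF T]
  have [measurable]: "?\<mu> \<in> borel_measurable borel"
    unfolding ts_mu_def by (intro borel_measurable_diff)
  note borel_measurable_Ln[measurable]
  have "(\<lambda>u. cylinder l (?\<mu> u)) \<in> borel_measurable borel"
    unfolding cylinder_def by measurable
  moreover
  define \<delta> where "\<delta> = 1 / (2 * (norm l + 1))"
  define p q where "p = ts_floor T c" and "q = ts_floor T d"
  let ?A = "{t \<in> T. p \<le> t \<and> t \<le> q \<and> \<delta> \<le> ts_mu T t}"
  have "\<delta> > 0" by (simp add: \<delta>_def add_nonneg_pos)
  then have fin: "finite ((\<lambda>t. norm (cylinder l (ts_mu T t))) ` ?A)"
    by (intro finite_imageI finite_large_gaps)
  let ?B = "Max (insert (2 * norm l) ((\<lambda>t. norm (cylinder l (ts_mu T t))) ` ?A))"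
  have "norm (cylinder l (?\<mu> u)) \<le> ?B" if u: "u \<in> {c..d}" for u
  proof (cases "\<delta> \<le> ?\<mu> u")
    case True
    then have "ts_floor T u \<in> ?A"
      using u ts_floor_mem[OF T] monoD[OF mono_ts_floor[OF T]] by (auto simp: p_def q_def)
    then show ?thesis using fin by (intro Max_ge) auto
  next
    case False
    then have "norm (cylinder l (?\<mu> u)) \<le> 2 * norm l"
      using mu_nonneg[OF T(1) ts_floor_mem[OF T]] by (intro cylinder_bound) (auto simp: \<delta>_def)
    also have "\<dots> \<le> ?B" using fin by (intro Max_ge) auto
    finally show ?thesis .
  qed
  ultimately show ?thesis by (rule integrable_on_bounded_borel)
qed

text \<open>The exponential of an antiderivative \<open>F\<close> of the cylinder transformation of the graininess. Over a gap
  it is multiplied by \<open>exp (m * cylinder l m) = 1 + m * l\<close>, at right-dense points \<open>F\<close> has derivative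
  \<open>l\<close> and the chain rule applies. Being an exponential, the solution has no zeros, and it is defined
  on both sides of \<open>a\<close> at once.\<close>

lemma complex_exponential_exists:
  fixes l :: complex
  assumes T: "closed T" "a \<in> T"
    and regr: "\<And>t. t \<in> ts_kappa T \<Longrightarrow> 1 + l * of_real (ts_mu T t) \<noteq> 0"
  obtains e where "e a = 1" "\<And>t. e t \<noteq> 0"
    "\<And>t. t \<in> ts_kappa T \<Longrightarrow> has_delta_derivative T e (l * e t) t"
proof -
  let ?f = "\<lambda>t. cylinder l (ts_mu T t)"
  have ne: "T \<noteq> {}" using T by auto
  have "continuous (at t within T) ?f" if t: "t \<in> T" "ts_sigma T t = t" for t
    unfolding continuous_within_eps_delta
  proof (intro allI impI)
    fix e :: real assume "e > 0"
    then obtain m where m: "m > 0" "\<And>x. \<bar>x\<bar> < m \<Longrightarrow> dist (cylinder l x) l < e"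
      using cylinder_tendsto by blast
    obtain d where d: "d > 0" "\<And>u. u \<in> T \<Longrightarrow> \<bar>u - t\<bar> < d \<Longrightarrow> ts_mu T u < m"
      using mu_small_near_right_dense[OF t m(1)] by blast
    have "?f t = l" using t by (simp add: cylinder_def ts_mu_def)
    then show "\<exists>d>0. \<forall>s\<in>T. dist s t < d \<longrightarrow> dist (?f s) (?f t) < e"
      using m d mu_nonneg[OF T(1)] by (intro exI[of _ d]) (auto simp: dist_real_def)
  qed
  then obtain F where F: "\<And>t. t \<in> T \<Longrightarrow> has_delta_derivative T F (?f t) t"
    using delta_antiderivative[OF T(1) ne cylinder_integrable[OF T(1) ne]] by blast
  define e where "e t = exp (F t - F a)" for t
  have "has_delta_derivative T e (l * e t) t" if "t \<in> ts_kappa T" for t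
  proof -
    have t: "t \<in> T" using that kappa_subset by auto
    show ?thesis
    proof (cases "ts_sigma T t = t")
      case True
      then have "(F has_vector_derivative l) (at t within T)"
        using F[OF t] by (simp add: has_delta_derivative_dense_iff cylinder_def ts_mu_def)
      then have "((\<lambda>t. F t - F a) has_vector_derivative l) (at t within T)"
        by (auto intro!: derivative_eq_intros)
      from field_vector_diff_chain_within[OF this DERIV_subset[OF DERIV_exp]]
      have "(e has_vector_derivative l * e t) (at t within T)"
        by (simp add: e_def[abs_def] o_def)
      then show ?thesis by (simp add: has_delta_derivative_dense_iff[OF True])
    next
      case False
      then have cont: "continuous (at t within T) F" and eq: "F (ts_sigma T t) = F t + ts_mu T t *\<^sub>R ?f t"
        using F[OF t] by (auto simp: has_delta_derivative_iff[OF T(1) t])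
      have "e (ts_sigma T t) = e t * exp (of_real (ts_mu T t) * ?f t)"
        by (simp add: e_def eq scaleR_conv_of_real flip: exp_add) (simp add: algebra_simps)
      also have "\<dots> = e t + ts_mu T t *\<^sub>R (l * e t)"
        using regr[OF that] by (subst exp_cylinder) (auto simp: scaleR_conv_of_real algebra_simps)
      finally have "e (ts_sigma T t) = e t + ts_mu T t *\<^sub>R (l * e t)" .
      moreover have "continuous (at t within T) e"
        unfolding e_def using cont by (intro continuous_intros)
      ultimately show ?thesis using False by (simp add: has_delta_derivative_iff[OF T(1) t])
    qed
  qed
  then show thesis by (intro that[of e]) (auto simp: e_def)
qed

text \<open>The quotient of a solution by a solution without zeros has derivative zero: at right-dense points by
  the quotient rule, and over a gap because both are multiplied by the same factor. Hence it is
  constant. Uniqueness for the initial value problem is the case of equal values at \<open>b\<close>.\<close>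

lemma exponential_solution_multiple:
  fixes l :: "'a::real_normed_field"
  assumes T: "closed T" "b \<in> T" "t \<in> T"
    and e: "\<And>t. t \<in> T \<Longrightarrow> e t \<noteq> 0"
      "\<And>t. t \<in> ts_kappa T \<Longrightarrow> has_delta_derivative T e (l * e t) t"
    and y: "\<And>t. t \<in> ts_kappa T \<Longrightarrow> has_delta_derivative T y (l * y t) t"
  shows "y t = y b / e b * e t"
proof -
  have "has_delta_derivative T (\<lambda>t. y t / e t) 0 u" if u: "u \<in> ts_kappa T" for u
  proof -
    have uT: "u \<in> T" using u kappa_subset by auto
    note eu = e(2)[OF u] and yu = y[OF u]
    show ?thesis
    proof (cases "ts_sigma T u = u")
      case True
      have "((\<lambda>t. y t / e t) has_derivative
          (\<lambda>h. (h *\<^sub>R (l * y u) * e u - y u * (h *\<^sub>R (l * e u))) / (e u * e u))) (at u within T)"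
        using eu yu e(1)[OF uT] unfolding has_delta_derivative_dense_iff[OF True] has_vector_derivative_def
        by (intro has_derivative_divide') auto
      then show ?thesis
        unfolding has_delta_derivative_dense_iff[OF True] has_vector_derivative_def
        by (simp add: mult.assoc mult.left_commute mult.commute)
    next
      case False
      have s: "y (ts_sigma T u) = (1 + of_real (ts_mu T u) * l) * y u"
          "e (ts_sigma T u) = (1 + of_real (ts_mu T u) * l) * e u"
        using has_delta_derivative_sigma[OF yu uT] has_delta_derivative_sigma[OF eu uT]
        by (simp_all add: scaleR_conv_of_real algebra_simps)
      moreover have "e (ts_sigma T u) \<noteq> 0" "e u \<noteq> 0"
        using e(1) sigma_mem[OF T(1) uT] uT by auto
      ultimately have "y (ts_sigma T u) / e (ts_sigma T u) = y u / e u"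
        by auto
      moreover have "continuous (at u within T) (\<lambda>t. y t / e t)"
        using e(1)[OF uT] has_delta_derivative_continuous[OF T(1) uT] eu yu
        by (intro continuous_at_within_divide) auto
      ultimately show ?thesis using False by (simp add: has_delta_derivative_iff[OF T(1) uT])
    qed
  qed
  then have "y t / e t = y b / e b"
    by (intro zero_delta_derivative_imp_constant[OF T(1) T(3) T(2)])
  then show ?thesis using e(1)[OF T(3)] by (simp add: field_simps)
qed

text \<open>For real \<open>l\<close> the complex conjugate of the complex solution solves the same initial value problem, so
  by uniqueness the solution is real on \<open>T\<close>, and its real part has no zeros there. Taking the detour through
  the complex numbers covers negative factors \<open>1 + l * ts_mu T t\<close>, which have no real logarithm.\<close>

lemma real_exponential_exists:
  fixes l :: real
  assumes T: "closed T" "a \<in> T"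
    and regr: "\<And>t. t \<in> ts_kappa T \<Longrightarrow> 1 + l * ts_mu T t \<noteq> 0"
  obtains e where "e a = 1" "\<And>t. t \<in> T \<Longrightarrow> e t \<noteq> 0"
    "\<And>t. t \<in> ts_kappa T \<Longrightarrow> has_delta_derivative T e (l * e t) t"
proof -
  have "1 + complex_of_real l * of_real (ts_mu T t) \<noteq> 0" if "t \<in> ts_kappa T" for t
    using regr[OF that] by (metis of_real_0 of_real_1 of_real_add of_real_eq_iff of_real_mult)
  then obtain E where E: "E a = 1" "\<And>t. E t \<noteq> 0"
    "\<And>t. t \<in> ts_kappa T \<Longrightarrow> has_delta_derivative T E (complex_of_real l * E t) t"
    using complex_exponential_exists[OF T] by blast
  have "has_delta_derivative T (\<lambda>t. cnj (E t)) (complex_of_real l * cnj (E t)) t" if "t \<in> ts_kappa T" for t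
    using has_delta_derivative_bounded_linear[OF bounded_linear_cnj T(1) _ E(3)[OF that]] kappa_subset that by auto
  from exponential_solution_multiple[OF T _ E(2,3) this]
  have "cnj (E t) = E t" if "t \<in> T" for t
    using that E(1) by simp
  then have "Re (E t) \<noteq> 0" if "t \<in> T" for t
    using E(2)[of t] that by (auto simp: complex_eq_iff)
  moreover have "has_delta_derivative T (\<lambda>t. Re (E t)) (l * Re (E t)) t" if "t \<in> ts_kappa T" for t
    using has_delta_derivative_bounded_linear[OF bounded_linear_Re T(1) _ E(3)[OF that]] kappa_subset that by auto
  ultimately show thesis using that[of "\<lambda>t. Re (E t)"] E(1) by simp
qed

lemma ts_exp_eq:
  fixes l :: "'a::real_normed_field"
  assumes T: "closed T" "a \<in> T" "t \<in> T"
    and e: "e a = 1" "\<And>t. t \<in> T \<Longrightarrow> e t \<noteq> 0"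
      "\<And>t. t \<in> ts_kappa T \<Longrightarrow> has_delta_derivative T e (l * e t) t"
  shows "ts_exp T l t a = e t"
  unfolding ts_exp_def
proof (rule the_equality)
  fix v assume "\<exists>y. (\<forall>\<tau>\<in>ts_kappa T. has_delta_derivative T y (l * y \<tau>) \<tau>) \<and> y a = 1 \<and> v = y t"
  then obtain y where "\<And>\<tau>. \<tau> \<in> ts_kappa T \<Longrightarrow> has_delta_derivative T y (l * y \<tau>) \<tau>" "y a = 1" "v = y t"
    by blast
  then show "v = e t"
    using exponential_solution_multiple[OF T e(2,3), of y] e(1) by simp
qed (use e in blast)

section \<open>Differentiation on the time scale without its left-scattered maximum\<close>

text \<open>A continuous delta derivative is also the delta derivative relative to \<open>ts_kappa T\<close>, the sense in
  which the second derivative is formed. The jump operators can differ only at the maximum of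
  \<open>ts_kappa T\<close>. If that point is left-dense but right-scattered in \<open>T\<close>, then the derivative
  relative to \<open>T\<close> is a difference quotient to the right, whereas the one relative to \<open>ts_kappa T\<close> is a
  limit from the left; by the mean value inequality the latter is the limit of the derivatives.\<close>

lemma has_delta_derivative_kappa:
  fixes F :: "real \<Rightarrow> 'a::real_normed_vector"
  assumes T: "closed T"
    and F: "\<And>t. t \<in> ts_kappa T \<Longrightarrow> has_delta_derivative T F (f t) t"
    and f: "continuous_on (ts_kappa T) f" and t: "t \<in> ts_kappa T"
  shows "has_delta_derivative (ts_kappa T) F (f t) t"
proof (cases "\<exists>s\<in>ts_kappa T. t < s")
  case True
  let ?K = "ts_kappa T"
  obtain s where s: "s \<in> ?K" "t < s" using True by auto
  have "Inf {s \<in> ?K. t < s} = Inf {s \<in> T. t < s}"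
  proof (rule antisym)
    have "\<exists>a\<in>{s \<in> ?K. t < s}. a \<le> b" if b: "b \<in> {s \<in> T. t < s}" for b
    proof (cases "b \<in> ?K")
      case False
      then have "s \<le> b" using b s kappa_subset[of T] by (auto simp: ts_kappa_def)
      then show ?thesis using s by blast
    qed (use b in blast)
    then show "Inf {s \<in> ?K. t < s} \<le> Inf {s \<in> T. t < s}"
      using s kappa_subset[of T] by (intro cInf_mono) (auto intro!: bdd_belowI[of _ t])
    show "Inf {s \<in> T. t < s} \<le> Inf {s \<in> ?K. t < s}"
      using s kappa_subset[of T] by (intro cInf_superset_mono) (auto intro!: bdd_belowI[of _ t])
  qed
  then have "ts_sigma ?K t = ts_sigma T t"
    using s kappa_subset[of T] by (auto simp: ts_sigma_def)
  then show ?thesis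
    using F[OF t] kappa_subset[of T] unfolding has_delta_derivative_def by (simp, meson Int_iff subsetD)
next
  case False
  then have sg: "ts_sigma (ts_kappa T) t = t" by (simp add: ts_sigma_def)
  have tT: "t \<in> T" using t kappa_subset by auto
  show ?thesis
    unfolding has_delta_derivative_iff_delta sg
  proof (intro allI impI)
    fix e :: real assume "e > 0"
    then obtain d where d: "d > 0" "\<And>u. u \<in> ts_kappa T \<Longrightarrow> dist u t < d \<Longrightarrow> dist (f u) (f t) < e"
      using f t \<open>e > 0\<close> unfolding continuous_on_iff by blast
    have "norm (F t - F s - (t - s) *\<^sub>R f t) \<le> e * \<bar>t - s\<bar>" if s: "s \<in> ts_kappa T" "\<bar>s - t\<bar> < d" for s
    proof -
      have "s \<le> t" using False s by force
      have sT: "s \<in> T" using s kappa_subset by auto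
      have D: "has_delta_derivative T (\<lambda>u. F u - u *\<^sub>R f t) (f u - f t) u" if "u \<in> ts_kappa T" for u
      proof (rule has_delta_derivative_diff[OF T _ F[OF that]])
        show "has_delta_derivative T (\<lambda>u. u *\<^sub>R f t) (f t) u"
          unfolding has_delta_derivative_iff_delta scaleR_left_diff_distrib[symmetric]
          by (auto intro: exI[of _ 1])
      qed (use that kappa_subset in auto)
      have "norm ((F t - t *\<^sub>R f t) - (F s - s *\<^sub>R f t)) \<le> e * (t - s)"
      proof (rule delta_mean_value_inequality[OF T sT tT \<open>s \<le> t\<close> continuous_on_of_has_delta_derivative[OF T D]])
        fix u assume u: "u \<in> T" "s \<le> u" "u < t"
        then have uK: "u \<in> ts_kappa T" using less_mem_kappa tT by blast
        show "has_delta_derivative T (\<lambda>u. F u - u *\<^sub>R f t) (f u - f t) u" by (rule D[OF uK])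
        show "norm (f u - f t) \<le> e" using d(2)[OF uK] u s by (auto simp: dist_norm dist_real_def)
      qed
      then show ?thesis using \<open>s \<le> t\<close> by (simp add: algebra_simps)
    qed
    then show "\<exists>\<delta>>0. \<forall>s\<in>ts_kappa T. \<bar>s - t\<bar> < \<delta> \<longrightarrow> norm (F t - F s - (t - s) *\<^sub>R f t) \<le> e * \<bar>t - s\<bar>"
      using d(1) by blast
  qed
qed

lemma exponential_solution_kappa:
  fixes l :: "'a::real_normed_field"
  assumes T: "closed T"
    and e: "\<And>t. t \<in> ts_kappa T \<Longrightarrow> has_delta_derivative T e (l * e t) t" and t: "t \<in> ts_kappa T"
  shows "has_delta_derivative (ts_kappa T) e (l * e t) t"
  using continuous_on_of_has_delta_derivative[OF T e] kappa_subset[of T]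
  by (intro has_delta_derivative_kappa[OF T e _ t] continuous_on_mult_left)
    (auto intro: continuous_on_subset)

section \<open>Solutions of the second order equation\<close>

lemma delta_deriv_eq:
  assumes "closed T" "t \<in> ts_kappa T" "\<exists>s\<in>T. s \<noteq> t" "has_delta_derivative T f D t"
  shows "delta_deriv T f t = D"
  unfolding delta_deriv_def
  using assms has_delta_derivative_unique by (intro the_equality) blast+

text \<open>Derivatives are unique here, so a solution can be presented, or taken apart, together with its two
  derivatives as functions, without evaluating the descriptions in \<open>delta_deriv\<close>.\<close>

lemma dynamic_solution_iff:
  fixes y :: "real \<Rightarrow> 'a::real_normed_field"
  assumes T: "closed T" and S: "S \<subseteq> T" "card S = 3"
  shows "dynamic_solution T \<alpha> \<beta> f y \<longleftrightarrow>
    (\<exists>y1 y2. (\<forall>t\<in>ts_kappa T. has_delta_derivative T y (y1 t) t) \<and>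
      (\<forall>t\<in>ts_kappa (ts_kappa T). has_delta_derivative (ts_kappa T) y1 (y2 t) t
        \<and> y2 t + 2 * of_real \<alpha> * y1 t + of_real \<beta> * y t = f t))"
proof
  let ?K = "ts_kappa T"
  have fin: "finite S" using S by (metis card.infinite zero_neq_numeral)
  have two: "\<exists>s\<in>?K. s \<noteq> t" for t
  proof (rule ccontr)
    assume H: "\<not> (\<exists>s\<in>?K. s \<noteq> t)"
    \<comment> \<open>Three points of \<open>T\<close> leave at least two in \<open>ts_kappa T\<close>, so derivatives relative to both are unique.\<close>
    obtain M where "T - {M} \<subseteq> ?K" by (cases rule: kappa_cases[of T]) auto
    then have "S \<subseteq> {M, t}" using H S by auto
    from card_mono[OF _ this] have "card S \<le> 2" by (auto simp: card_insert_if split: if_splits)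
    then show False using S by simp
  qed
  then have twoT: "\<exists>s\<in>T. s \<noteq> t" for t using kappa_subset[of T] by blast
  have K: "closed ?K" by (rule closed_kappa[OF T])
  have D1: "delta_deriv T g t = D" if "t \<in> ?K" "has_delta_derivative T g D t" for g :: "real \<Rightarrow> 'a" and t D
    using delta_deriv_eq[OF T that(1) twoT that(2)] .
  have D2: "delta_deriv ?K g t = D" if "t \<in> ts_kappa ?K" "has_delta_derivative ?K g D t" for g :: "real \<Rightarrow> 'a" and t D
    using delta_deriv_eq[OF K that(1) two that(2)] .
  {
    assume L: "dynamic_solution T \<alpha> \<beta> f y"
    let ?y1 = "delta_deriv T y"
    show "\<exists>y1 y2. (\<forall>t\<in>?K. has_delta_derivative T y (y1 t) t) \<and>
      (\<forall>t\<in>ts_kappa ?K. has_delta_derivative ?K y1 (y2 t) t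
        \<and> y2 t + 2 * of_real \<alpha> * y1 t + of_real \<beta> * y t = f t)"
    proof (intro exI conjI ballI)
      show "has_delta_derivative T y (?y1 t) t" if t: "t \<in> ?K" for t
      proof -
        obtain D where "has_delta_derivative T y D t"
          using L t unfolding dynamic_solution_def delta_differentiable_def by blast
        with D1[OF t this] show ?thesis by simp
      qed
      show "has_delta_derivative ?K ?y1 (delta_deriv ?K ?y1 t) t" if t: "t \<in> ts_kappa ?K" for t
      proof -
        obtain D where "has_delta_derivative ?K ?y1 D t"
          using L t unfolding dynamic_solution_def delta_differentiable_def by blast
        with D2[OF t this] show ?thesis by simp
      qed
      show "delta_deriv ?K ?y1 t + 2 * of_real \<alpha> * ?y1 t + of_real \<beta> * y t = f t" if "t \<in> ts_kappa ?K" for t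
        using L that unfolding dynamic_solution_def by blast
    qed
  }
  assume "\<exists>y1 y2. (\<forall>t\<in>?K. has_delta_derivative T y (y1 t) t) \<and>
      (\<forall>t\<in>ts_kappa ?K. has_delta_derivative ?K y1 (y2 t) t
        \<and> y2 t + 2 * of_real \<alpha> * y1 t + of_real \<beta> * y t = f t)"
  then obtain y1 y2 where y: "\<And>t. t \<in> ?K \<Longrightarrow> has_delta_derivative T y (y1 t) t"
    "\<And>t. t \<in> ts_kappa ?K \<Longrightarrow> has_delta_derivative ?K y1 (y2 t) t"
    "\<And>t. t \<in> ts_kappa ?K \<Longrightarrow> y2 t + 2 * of_real \<alpha> * y1 t + of_real \<beta> * y t = f t" by blast
  have KK: "t \<in> ts_kappa ?K \<Longrightarrow> t \<in> ?K" for t using kappa_subset[of ?K] by auto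
  have eq1: "delta_deriv T y t = y1 t" if "t \<in> ?K" for t
    using D1[OF that y(1)[OF that]] .
  have dd2: "has_delta_derivative ?K (delta_deriv T y) (y2 t) t" if "t \<in> ts_kappa ?K" for t
    using has_delta_derivative_cong[OF K KK[OF that], of "delta_deriv T y" y1] eq1 y(2)[OF that] by simp
  show "dynamic_solution T \<alpha> \<beta> f y"
    unfolding dynamic_solution_def delta_differentiable_def
  proof (intro conjI ballI)
    show "\<exists>D. has_delta_derivative T y D t" if "t \<in> ?K" for t using y(1)[OF that] by blast
    show "\<exists>D. has_delta_derivative ?K (delta_deriv T y) D t" if "t \<in> ts_kappa ?K" for t
      using dd2[OF that] by blast
    show "delta_deriv ?K (delta_deriv T y) t + 2 * of_real \<alpha> * delta_deriv T y t + of_real \<beta> * y t = f t"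
      if t: "t \<in> ts_kappa ?K" for t
      using y(3)[OF t] D2[OF t dd2[OF t]] eq1[OF KK[OF t]] by simp
  qed
qed

text \<open>The operator factors: \<open>z\<^sup>\<Delta> - l2 z\<close> solves the first order equation for \<open>l1\<close> on the time scale
  \<open>ts_kappa T\<close>, and vice versa, so these are multiples \<open>A e1\<close> and \<open>B e2\<close>. Solving the two linear
  equations gives \<open>z\<close> and \<open>z\<^sup>\<Delta>\<close> on \<open>ts_kappa T\<close>. The difference of \<open>z\<close> and the combination so
  found has derivative zero, hence it vanishes also at a removed maximum of \<open>T\<close>. The initial point
  of the exponentials may be this maximum, so the comparison is made at a point \<open>b\<close> of \<open>ts_kappa T\<close>.\<close>

lemma homogeneous_solution_form:
  fixes z z1 :: "real \<Rightarrow> 'a::real_normed_field"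
  assumes T: "closed T" and b: "b \<in> ts_kappa T" and neq: "l1 \<noteq> l2"
    and z: "\<And>t. t \<in> ts_kappa T \<Longrightarrow> has_delta_derivative T z (z1 t) t"
    and z1: "\<And>t. t \<in> ts_kappa (ts_kappa T) \<Longrightarrow>
      has_delta_derivative (ts_kappa T) z1 ((l1 + l2) * z1 t - l1 * l2 * z t) t"
    and e1: "\<And>t. t \<in> T \<Longrightarrow> e1 t \<noteq> 0"
      "\<And>t. t \<in> ts_kappa T \<Longrightarrow> has_delta_derivative T e1 (l1 * e1 t) t"
    and e2: "\<And>t. t \<in> T \<Longrightarrow> e2 t \<noteq> 0"
      "\<And>t. t \<in> ts_kappa T \<Longrightarrow> has_delta_derivative T e2 (l2 * e2 t) t"
  shows "\<exists>c1 c2. \<forall>t\<in>T. z t = c1 * e1 t + c2 * e2 t"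
proof -
  let ?K = "ts_kappa T"
  have K: "closed ?K" by (rule closed_kappa[OF T])
  have KT: "t \<in> T" if "t \<in> ?K" for t using that kappa_subset by auto
  have KK: "t \<in> ?K" if "t \<in> ts_kappa ?K" for t using that kappa_subset by auto
  have zK: "has_delta_derivative ?K z (z1 t) t" if "t \<in> ?K" for t
    using has_delta_derivative_kappa[OF T z continuous_on_of_has_delta_derivative[OF K z1] that] .
  note eK = exponential_solution_kappa[OF T]
  have factor: "\<exists>A. \<forall>t\<in>?K. z1 t - l' * z t = A * e t"
    if e: "\<And>t. t \<in> T \<Longrightarrow> e t \<noteq> 0" "\<And>t. t \<in> ?K \<Longrightarrow> has_delta_derivative T e (l * e t) t"
      and l: "l + l' = l1 + l2" "l * l' = l1 * l2" for e :: "real \<Rightarrow> 'a" and l l'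
  proof -
    have "has_delta_derivative ?K (\<lambda>t. z1 t - l' * z t) (l * (z1 t - l' * z t)) t" if "t \<in> ts_kappa ?K" for t
    proof -
      have "has_delta_derivative ?K (\<lambda>t. z1 t - l' * z t)
          ((l + l') * z1 t - l * l' * z t - l' * z1 t) t"
        using has_delta_derivative_diff[OF K KK[OF that] z1[OF that]
          has_delta_derivative_mult[OF K KK[OF that] zK[OF KK[OF that]]]] unfolding l .
      then show ?thesis by (simp add: algebra_simps)
    qed
    from exponential_solution_multiple[OF K b _ e(1)[OF KT] eK[OF e(2) KK] this]
    show ?thesis by blast
  qed
  obtain A where A: "\<forall>t\<in>?K. z1 t - l2 * z t = A * e1 t"
    using factor[OF e1] by auto
  obtain B where B: "\<forall>t\<in>?K. z1 t - l1 * z t = B * e2 t"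
    using factor[OF e2, of l1] by (auto simp: algebra_simps)
  define c1 c2 where "c1 = A / (l1 - l2)" and "c2 = - B / (l1 - l2)"
  define D where "D t = z t - (c1 * e1 t + c2 * e2 t)" for t
  have D: "D t = 0" "z1 t - (c1 * (l1 * e1 t) + c2 * (l2 * e2 t)) = 0" if "t \<in> ?K" for t
  proof -
    have "c1 * e1 t = (z1 t - l2 * z t) / (l1 - l2)" "c2 * e2 t = - (z1 t - l1 * z t) / (l1 - l2)"
      using A B that by (auto simp: c1_def c2_def)
    moreover from this have "c1 * (l1 * e1 t) + c2 * (l2 * e2 t)
        = l1 * ((z1 t - l2 * z t) / (l1 - l2)) + l2 * (- (z1 t - l1 * z t) / (l1 - l2))"
      by (simp only: mult.left_commute[of c1] mult.left_commute[of c2])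
    moreover have "(z1 t - l2 * z t) / (l1 - l2) + - (z1 t - l1 * z t) / (l1 - l2) = z t"
      "l1 * ((z1 t - l2 * z t) / (l1 - l2)) + l2 * (- (z1 t - l1 * z t) / (l1 - l2)) = z1 t"
      using neq by (simp_all add: divide_simps) (simp_all add: algebra_simps)
    ultimately show "D t = 0" "z1 t - (c1 * (l1 * e1 t) + c2 * (l2 * e2 t)) = 0"
      by (simp_all add: D_def)
  qed
  have "D t = D b" if "t \<in> T" for t
  proof (rule zero_delta_derivative_imp_constant[OF T that KT[OF b]])
    fix u assume u: "u \<in> ?K"
    have "has_delta_derivative T D (z1 u - (c1 * (l1 * e1 u) + c2 * (l2 * e2 u))) u"
      unfolding D_def by (intro has_delta_derivative_diff has_delta_derivative_add has_delta_derivative_mult T KT[OF u] z e1(2) e2(2) u)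
    then show "has_delta_derivative T D 0 u" using D(2)[OF u] by simp
  qed
  then have "\<forall>t\<in>T. z t = c1 * e1 t + c2 * e2 t"
    using D(1)[OF b] by (simp add: D_def)
  then show ?thesis by blast
qed

lemma general_solution_from_particular:
  fixes e1 e2 p f :: "real \<Rightarrow> 'a::real_normed_field"
  assumes T: "closed T" and S: "S \<subseteq> T" "card S = 3" and neq: "l1 \<noteq> l2"
    and l: "l1 + l2 = - 2 * of_real \<alpha>" "l1 * l2 = of_real \<beta>"
    and e1: "\<And>t. t \<in> T \<Longrightarrow> e1 t \<noteq> 0"
      "\<And>t. t \<in> ts_kappa T \<Longrightarrow> has_delta_derivative T e1 (l1 * e1 t) t"
    and e2: "\<And>t. t \<in> T \<Longrightarrow> e2 t \<noteq> 0"
      "\<And>t. t \<in> ts_kappa T \<Longrightarrow> has_delta_derivative T e2 (l2 * e2 t) t"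
    and p: "dynamic_solution T \<alpha> \<beta> f p"
  shows "dynamic_solution T \<alpha> \<beta> f y \<longleftrightarrow> (\<exists>c1 c2. \<forall>t\<in>T. y t = c1 * e1 t + c2 * e2 t + p t)"
proof
  let ?K = "ts_kappa T"
  have K: "closed ?K" by (rule closed_kappa[OF T])
  have KT: "t \<in> T" if "t \<in> ?K" for t using that kappa_subset by auto
  have KK: "t \<in> ?K" if "t \<in> ts_kappa ?K" for t using that kappa_subset by auto
  obtain p1 p2 where p: "\<And>t. t \<in> ?K \<Longrightarrow> has_delta_derivative T p (p1 t) t"
    "\<And>t. t \<in> ts_kappa ?K \<Longrightarrow> has_delta_derivative ?K p1 (p2 t) t"
    "\<And>t. t \<in> ts_kappa ?K \<Longrightarrow> p2 t + 2 * of_real \<alpha> * p1 t + of_real \<beta> * p t = f t"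
    using p unfolding dynamic_solution_iff[OF T S] by blast
  {
    assume "dynamic_solution T \<alpha> \<beta> f y"
    then obtain y1 y2 where y: "\<And>t. t \<in> ?K \<Longrightarrow> has_delta_derivative T y (y1 t) t"
      "\<And>t. t \<in> ts_kappa ?K \<Longrightarrow> has_delta_derivative ?K y1 (y2 t) t"
      "\<And>t. t \<in> ts_kappa ?K \<Longrightarrow> y2 t + 2 * of_real \<alpha> * y1 t + of_real \<beta> * y t = f t"
      unfolding dynamic_solution_iff[OF T S] by blast
    have "?K \<noteq> {}"
    proof
      assume "?K = {}"
      then obtain M where "T \<subseteq> {M}" by (cases rule: kappa_cases[of T]) auto
      then have "card S \<le> card {M}" using S by (intro card_mono) auto
      then show False using S by simp
    qed
    then obtain b where b: "b \<in> ?K" by auto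
    have "\<exists>c1 c2. \<forall>t\<in>T. y t - p t = c1 * e1 t + c2 * e2 t"
    proof (rule homogeneous_solution_form[OF T b neq _ _ e1 e2])
      show "has_delta_derivative T (\<lambda>t. y t - p t) (y1 t - p1 t) t" if "t \<in> ?K" for t
        by (intro has_delta_derivative_diff T KT y p that)
      show "has_delta_derivative ?K (\<lambda>t. y1 t - p1 t)
          ((l1 + l2) * (y1 t - p1 t) - l1 * l2 * (y t - p t)) t" if t: "t \<in> ts_kappa ?K" for t
      proof -
        have "y2 t = f t - 2 * of_real \<alpha> * y1 t - of_real \<beta> * y t"
          "p2 t = f t - 2 * of_real \<alpha> * p1 t - of_real \<beta> * p t"
          using y(3)[OF t] p(3)[OF t] by (auto simp: algebra_simps)
        then have "y2 t - p2 t = (l1 + l2) * (y1 t - p1 t) - l1 * l2 * (y t - p t)"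
          unfolding l by (simp add: algebra_simps)
        then show ?thesis
          using has_delta_derivative_diff[OF K KK[OF t] y(2)[OF t] p(2)[OF t]] by simp
      qed
    qed
    then show "\<exists>c1 c2. \<forall>t\<in>T. y t = c1 * e1 t + c2 * e2 t + p t"
      by (metis diff_add_cancel)
  next
    assume "\<exists>c1 c2. \<forall>t\<in>T. y t = c1 * e1 t + c2 * e2 t + p t"
    then obtain c1 c2 where c: "\<And>t. t \<in> T \<Longrightarrow> y t = c1 * e1 t + c2 * e2 t + p t" by blast
    note eK = exponential_solution_kappa[OF T]
    let ?y1 = "\<lambda>t. c1 * (l1 * e1 t) + c2 * (l2 * e2 t) + p1 t"
    let ?y2 = "\<lambda>t. c1 * (l1 * (l1 * e1 t)) + c2 * (l2 * (l2 * e2 t)) + p2 t"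
    have "has_delta_derivative T y (?y1 t) t" if "t \<in> ?K" for t
    proof -
      have "has_delta_derivative T (\<lambda>t. c1 * e1 t + c2 * e2 t + p t) (?y1 t) t"
        by (intro has_delta_derivative_add has_delta_derivative_mult T KT e1(2) e2(2) p that)
      then show ?thesis
        using has_delta_derivative_cong[OF T KT[OF that], of y "\<lambda>t. c1 * e1 t + c2 * e2 t + p t"] c by simp
    qed
    moreover have "has_delta_derivative ?K ?y1 (?y2 t) t" if "t \<in> ts_kappa ?K" for t
      by (intro has_delta_derivative_add has_delta_derivative_mult K KK[OF that] eK[OF e1(2)] eK[OF e2(2)] p(2)[OF that])
    moreover have "?y2 t + 2 * of_real \<alpha> * ?y1 t + of_real \<beta> * y t = f t" if t: "t \<in> ts_kappa ?K" for t
    proof -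
      have a: "2 * of_real \<alpha> = - (l1 + l2)" using l by simp
      show ?thesis
        using p(3)[OF t] unfolding c[OF KT[OF KK[OF t]]] a l(2)[symmetric]
        by (simp add: algebra_simps)
    qed
    ultimately show "dynamic_solution T \<alpha> \<beta> f y"
      unfolding dynamic_solution_iff[OF T S] by (intro exI[of _ ?y1] exI[of _ ?y2]) blast
  }
qed

section \<open>The coefficient recurrence\<close>

lemma lambda_sum: "lambda1 \<alpha> r + lambda2 \<alpha> r = - 2 * of_real \<alpha>"
  by (simp add: lambda1_def lambda2_def)

lemma lambda_prod:
  assumes "r\<^sup>2 = of_real (\<alpha>\<^sup>2 - \<beta>)"
  shows "lambda1 \<alpha> r * lambda2 \<alpha> r = of_real \<beta>"
proof -
  have "lambda1 \<alpha> r * lambda2 \<alpha> r = (of_real \<alpha>)\<^sup>2 - r\<^sup>2"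
    by (simp add: lambda1_def lambda2_def algebra_simps power2_eq_square)
  then show ?thesis unfolding assms by simp
qed

text \<open>As \<open>\<beta> = \<lambda>\<^sub>1 \<lambda>\<^sub>2\<close>, the powers in the double sum combine to \<open>\<lambda>\<^sub>1 ^ (m - 1 - \<tau>) * \<lambda>\<^sub>2 ^ (\<tau> - 1 - s)\<close>. So the
  double sum arises from \<open>\<gamma>\<close> by two first order recursions with factors \<open>\<lambda>\<^sub>2\<close> and \<open>\<lambda>\<^sub>1\<close>, started
  at zero, which together solve the inhomogeneous recurrence.\<close>

lemma double_sum_recurrence:
  fixes r :: "'a::real_normed_field"
  assumes r: "r\<^sup>2 = of_real (\<alpha>\<^sup>2 - \<beta>)" and \<beta>: "\<beta> \<noteq> 0"
  shows "double_sum \<alpha> \<beta> \<gamma> r (Suc (Suc m)) + 2 * of_real \<alpha> * double_sum \<alpha> \<beta> \<gamma> r (Suc m)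
    + of_real \<beta> * double_sum \<alpha> \<beta> \<gamma> r m = of_real (\<gamma> m)"
proof -
  define l1 l2 where "l1 = lambda1 \<alpha> r" and "l2 = lambda2 \<alpha> r"
  have prod: "of_real \<beta> = l1 * l2"
    using lambda_prod[OF r] by (simp add: l1_def l2_def)
  have sum: "2 * of_real \<alpha> = - (l1 + l2)"
    using lambda_sum[of \<alpha> r] by (simp add: l1_def l2_def)
  have "l1 \<noteq> 0" using prod \<beta> by auto
  let ?D = "double_sum \<alpha> \<beta> \<gamma> r"
  define E where "E \<tau> = (\<Sum>s<\<tau>. of_real (\<gamma> s) * l2 ^ (\<tau> - 1 - s))" for \<tau>
  have D: "?D m = (\<Sum>\<tau><m. l1 ^ (m - 1 - \<tau>) * E \<tau>)" for m
    unfolding double_sum_def E_def sum_distrib_left l1_def[symmetric]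
  proof (intro sum.cong refl)
    fix \<tau> s assume "\<tau> \<in> {..<m}" "s \<in> {..<\<tau>}"
    then have "int m + int s - 2 * int \<tau> + int (\<tau> - 1 - s) = int (m - 1 - \<tau>)" by auto
    then have eq: "l1 powi (int m + int s - 2 * int \<tau>) * l1 ^ (\<tau> - 1 - s) = l1 ^ (m - 1 - \<tau>)"
      using power_int_add[of l1 "int m + int s - 2 * int \<tau>" "int (\<tau> - 1 - s)"] \<open>l1 \<noteq> 0\<close> by simp
    show "of_real (\<gamma> s) * l1 powi (int m + int s - 2 * int \<tau>) * of_real \<beta> ^ (\<tau> - 1 - s)
        = l1 ^ (m - 1 - \<tau>) * (of_real (\<gamma> s) * l2 ^ (\<tau> - 1 - s))"
      unfolding prod power_mult_distrib eq[symmetric] by (simp only: mult_ac)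
  qed
  have shift: "(\<Sum>i<m. c i * x ^ (Suc m - 1 - i)) = x * (\<Sum>i<m. c i * x ^ (m - 1 - i))" for c and x :: 'a and m
    unfolding sum_distrib_left
  proof (intro sum.cong refl)
    fix i assume "i \<in> {..<m}"
    then have "Suc m - 1 - i = Suc (m - 1 - i)" by auto
    then show "c i * x ^ (Suc m - 1 - i) = x * (c i * x ^ (m - 1 - i))" by (simp add: mult.left_commute)
  qed
  have E_Suc: "E (Suc m) = l2 * E m + of_real (\<gamma> m)" for m
    using shift[of "\<lambda>s. of_real (\<gamma> s)" l2 m] by (simp add: E_def)
  have D_Suc: "?D (Suc m) = l1 * ?D m + E m" for m
    using shift[of E l1 m] by (simp add: D mult.commute)
  show ?thesis
    unfolding sum prod D_Suc E_Suc by (simp add: algebra_simps)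
qed

text \<open>The vector \<open>omega\<close> is chosen by inverting the matrix with rows \<open>(\<lambda>\<^sub>1 ^ (k - 1), \<lambda>\<^sub>2 ^ (k - 1))\<close> and
  \<open>(\<lambda>\<^sub>1 ^ k, \<lambda>\<^sub>2 ^ k)\<close>, whose determinant is \<open>d\<close> below, so that the closed form also takes the two
  prescribed values at \<open>k - 1\<close> and \<open>k\<close>.\<close>

lemma xi_eq:
  fixes r :: "'a::real_normed_field"
  assumes r: "r\<^sup>2 = of_real (\<alpha>\<^sup>2 - \<beta>)" "r \<noteq> 0" and \<beta>: "\<beta> \<noteq> 0" and k: "k \<ge> 1"
  shows "xi \<alpha> \<beta> k \<gamma> r i = omega \<alpha> \<beta> k \<gamma> r $ 1 * lambda1 \<alpha> r ^ i + omega \<alpha> \<beta> k \<gamma> r $ 2 * lambda2 \<alpha> r ^ i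
             + double_sum \<alpha> \<beta> \<gamma> r i"
proof -
  define l1 l2 where "l1 = lambda1 \<alpha> r" and "l2 = lambda2 \<alpha> r"
  have prod: "of_real \<beta> = l1 * l2"
    using lambda_prod[OF r(1)] by (simp add: l1_def l2_def)
  have diff: "2 * r = l2 - l1"
    by (simp add: l1_def l2_def lambda1_def lambda2_def)
  have l0: "l1 \<noteq> 0" "l2 \<noteq> 0" "l2 - l1 \<noteq> 0"
    using prod \<beta> diff[symmetric] r(2) by auto
  obtain j where j: "k = Suc j" using k by (cases k) auto
  define u v where "u = of_real (1 / \<beta> * (\<gamma> (k - 1) - 2 * \<alpha> / \<beta> * \<gamma> k)) - double_sum \<alpha> \<beta> \<gamma> r (k - 1)"
    and "v = of_real (1 / \<beta> * \<gamma> k) - double_sum \<alpha> \<beta> \<gamma> r k"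
  define d where "d = l1 ^ j * l2 ^ j * (l2 - l1)"
  have d: "2 * of_real \<beta> ^ j * r = d"
    unfolding prod d_def diff[symmetric] power_mult_distrib by (simp add: algebra_simps)
  have d0: "d \<noteq> 0" using l0 by (simp add: d_def)
  let ?w = "omega \<alpha> \<beta> k \<gamma> r"
  have w: "?w $ 1 = (l2 ^ k * u - l2 ^ j * v) / d" "?w $ 2 = (l1 ^ j * v - l1 ^ k * u) / d"
    unfolding omega_def l1_def[symmetric] l2_def[symmetric] u_def[symmetric] v_def[symmetric]
    by (simp_all add: matrix_vector_mult_def sum_2 j d)
  have "(l2 ^ k * u - l2 ^ j * v) * l1 ^ j + (l1 ^ j * v - l1 ^ k * u) * l2 ^ j = u * d"
    "(l2 ^ k * u - l2 ^ j * v) * l1 ^ k + (l1 ^ j * v - l1 ^ k * u) * l2 ^ k = v * d"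
    by (simp_all add: d_def j algebra_simps)
  then have "?w $ 1 * l1 ^ j + ?w $ 2 * l2 ^ j = (u * d) / d" "?w $ 1 * l1 ^ k + ?w $ 2 * l2 ^ k = (v * d) / d"
    unfolding w times_divide_eq_left add_divide_distrib[symmetric] by simp_all
  then have "?w $ 1 * l1 ^ j + ?w $ 2 * l2 ^ j = u" "?w $ 1 * l1 ^ k + ?w $ 2 * l2 ^ k = v"
    using d0 by simp_all
  then show ?thesis
    by (auto simp: xi_def u_def v_def j algebra_simps simp flip: l1_def l2_def)
qed

lemma xi_recurrence:
  fixes r :: "'a::real_normed_field"
  assumes r: "r\<^sup>2 = of_real (\<alpha>\<^sup>2 - \<beta>)" "r \<noteq> 0" and \<beta>: "\<beta> \<noteq> 0" and k: "k \<ge> 1"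
  shows "xi \<alpha> \<beta> k \<gamma> r (Suc (Suc i)) + 2 * of_real \<alpha> * xi \<alpha> \<beta> k \<gamma> r (Suc i)
    + of_real \<beta> * xi \<alpha> \<beta> k \<gamma> r i = of_real (\<gamma> i)"
proof -
  define l1 l2 where "l1 = lambda1 \<alpha> r" and "l2 = lambda2 \<alpha> r"
  have prod: "of_real \<beta> = l1 * l2"
    using lambda_prod[OF r(1)] by (simp add: l1_def l2_def)
  have sum: "2 * of_real \<alpha> = - (l1 + l2)"
    using lambda_sum[of \<alpha> r] by (simp add: l1_def l2_def)
  define x y where "x = omega \<alpha> \<beta> k \<gamma> r $ 1 * l1 ^ i" and "y = omega \<alpha> \<beta> k \<gamma> r $ 2 * l2 ^ i"
  let ?D = "double_sum \<alpha> \<beta> \<gamma> r"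
  have xi: "xi \<alpha> \<beta> k \<gamma> r i = x + y + ?D i"
    "xi \<alpha> \<beta> k \<gamma> r (Suc i) = l1 * x + l2 * y + ?D (Suc i)"
    "xi \<alpha> \<beta> k \<gamma> r (Suc (Suc i)) = l1 * (l1 * x) + l2 * (l2 * y) + ?D (Suc (Suc i))"
    unfolding xi_eq[OF assms] x_def y_def l1_def l2_def by (simp_all add: mult.left_commute)
  have alg: "l1 * (l1 * x) + l2 * (l2 * y) + d2 + - (l1 + l2) * (l1 * x + l2 * y + d1) + l1 * l2 * (x + y + d0)
      = d2 + - (l1 + l2) * d1 + l1 * l2 * d0" for d0 d1 d2
    by (simp add: algebra_simps)
  show ?thesis
    using double_sum_recurrence[OF r(1) \<beta>, of \<gamma> i] unfolding xi prod sum alg .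
qed

section \<open>The general solution\<close>

text \<open>Differentiation shifts the coefficients of a combination of time scale polynomials, so the equation
  compares coefficients: with zeros after index \<open>k\<close>, the sequence \<open>xi\<close> must satisfy the recurrence with
  right-hand side \<open>\<gamma> i\<close> for all \<open>i \<le> k\<close>. The two values at \<open>k\<close> and \<open>k - 1\<close> solve the two equations
  in which the zeros enter; the others hold by the recurrence for the closed form.\<close>

lemma xi_polynomial_solution:
  fixes r :: "'a::real_normed_field"
  assumes T: "closed T" and a: "a \<in> T" and S: "S \<subseteq> T" "card S = 3"
    and r: "r\<^sup>2 = of_real (\<alpha>\<^sup>2 - \<beta>)" "r \<noteq> 0" and \<beta>: "\<beta> \<noteq> 0" and k: "k \<ge> 1"
  shows "dynamic_solution T \<alpha> \<beta> (\<lambda>t. \<Sum>i=0..k. of_real (\<gamma> i * ts_poly T i t a))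
     (\<lambda>t. \<Sum>i=0..k. xi \<alpha> \<beta> k \<gamma> r i * of_real (ts_poly T i t a))"
proof -
  let ?K = "ts_kappa T"
  have K: "closed ?K" by (rule closed_kappa[OF T])
  have KT: "t \<in> T" if "t \<in> ?K" for t using that kappa_subset by auto
  have KK: "t \<in> ?K" if "t \<in> ts_kappa ?K" for t using that kappa_subset by auto
  define h :: "nat \<Rightarrow> real \<Rightarrow> 'a" where "h i t = of_real (ts_poly T i t a)" for i t
  define h' :: "nat \<Rightarrow> real \<Rightarrow> 'a" where "h' i t = (case i of 0 \<Rightarrow> 0 | Suc j \<Rightarrow> h j t)" for i t
  have h: "has_delta_derivative T (h i) (h' i t) t" if "t \<in> ?K" for i t
  proof (cases i)
    case 0
    then show ?thesis
      using has_delta_derivative_const[of T "1::'a" t] by (simp add: h_def[abs_def] h'_def)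
  next
    case (Suc j)
    have "has_delta_derivative T (\<lambda>t. ts_poly T (Suc j) t a) (ts_poly T j t a) t"
      by (rule ts_poly_Suc_has_delta_derivative[OF T a that])
    from has_delta_derivative_bounded_linear[OF bounded_linear_of_real T KT[OF that] this]
    show ?thesis using Suc by (simp add: h_def[abs_def] h'_def del: ts_poly.simps)
  qed
  have h'_cont: "continuous_on ?K (h' i)" for i
  proof (cases i)
    case (Suc j)
    have "continuous_on ?K (h j)"
      unfolding h_def using ts_poly_continuous[OF T a, of j] kappa_subset[of T]
      by (intro continuous_on_of_real) (auto intro: continuous_on_subset)
    then show ?thesis using Suc by (simp add: h'_def[abs_def])
  qed (simp add: h'_def[abs_def])
  have hK: "has_delta_derivative ?K (h i) (h' i t) t" if "t \<in> ?K" for i t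
    by (rule has_delta_derivative_kappa[OF T h h'_cont that])
  have lin: "has_delta_derivative R (\<lambda>t. \<Sum>i=0..n. X i * h i t) (\<Sum>i=0..n. X i * h' i t) t"
    if "closed R" "t \<in> R" "\<And>i. has_delta_derivative R (h i) (h' i t) t" for R n X t
    by (induction n) (auto intro!: has_delta_derivative_add has_delta_derivative_mult that)
  have shift: "(\<Sum>i=0..k. X i * h' i t) = (\<Sum>i=0..k. X (Suc i) * h i t)" if "X (Suc k) = 0" for X t
  proof -
    obtain j where j: "k = Suc j" using k by (cases k) auto
    show ?thesis
      using that unfolding j sum.atLeast0_atMost_Suc_shift[of "\<lambda>i. X i * h' i t"] sum.atLeast0_atMost_Suc[of _ j]
      by (simp add: h'_def)
  qed
  define X where "X i = (if i \<le> k then xi \<alpha> \<beta> k \<gamma> r i else 0)" for i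
  have X: "X (Suc (Suc i)) + 2 * of_real \<alpha> * X (Suc i) + of_real \<beta> * X i = of_real (\<gamma> i)" if ik: "i \<le> k" for i
  proof -
    consider "i = k" | "i = k - 1" "i \<noteq> k" | "Suc (Suc i) \<le> k"
      using ik by (cases "i = k"; cases "i = k - 1") auto
    then show ?thesis
    proof cases
      case 1
      then show ?thesis using \<beta> by (simp add: X_def xi_def)
    next
      case 2
      have "2 * \<alpha> * (1 / \<beta> * \<gamma> k) + \<beta> * (1 / \<beta> * (\<gamma> (k - 1) - 2 * \<alpha> / \<beta> * \<gamma> k)) = \<gamma> (k - 1)"
        using \<beta> by (simp add: field_simps)
      from arg_cong[OF this, of "of_real :: real \<Rightarrow> 'a"]
      have "2 * of_real \<alpha> * of_real (1 / \<beta> * \<gamma> k)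
          + of_real \<beta> * of_real (1 / \<beta> * (\<gamma> (k - 1) - 2 * \<alpha> / \<beta> * \<gamma> k)) = (of_real (\<gamma> (k - 1)) :: 'a)"
        by (simp only: of_real_add of_real_mult of_real_numeral)
      then show ?thesis using 2 k by (simp add: X_def xi_def del: of_real_mult of_real_diff of_real_divide)
    next
      case 3
      then show ?thesis using xi_recurrence[OF r \<beta> k] by (simp add: X_def)
    qed
  qed
  have X0: "X (Suc k) = 0" "X (Suc (Suc k)) = 0" by (simp_all add: X_def)
  have eq: "(\<Sum>i=0..k. xi \<alpha> \<beta> k \<gamma> r i * of_real (ts_poly T i t a)) = (\<Sum>i=0..k. X i * h i t)" for t
    by (intro sum.cong) (auto simp: X_def h_def)
  show ?thesis
    unfolding dynamic_solution_iff[OF T S] eq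
  proof (intro exI conjI ballI)
    show "has_delta_derivative T (\<lambda>t. \<Sum>i=0..k. X i * h i t) (\<Sum>i=0..k. X (Suc i) * h i t) t" if "t \<in> ?K" for t
      using lin[OF T KT[OF that] h[OF that], where n = k and X = X] unfolding shift[of X t, OF X0(1)] .
    show "has_delta_derivative ?K (\<lambda>t. \<Sum>i=0..k. X (Suc i) * h i t) (\<Sum>i=0..k. X (Suc (Suc i)) * h i t) t"
      if "t \<in> ts_kappa ?K" for t
      using lin[OF K KK[OF that] hK[OF KK[OF that]], where n = k and X = "\<lambda>i. X (Suc i)"]
      unfolding shift[of "\<lambda>i. X (Suc i)" t, OF X0(2)] .
    show "(\<Sum>i=0..k. X (Suc (Suc i)) * h i t) + 2 * of_real \<alpha> * (\<Sum>i=0..k. X (Suc i) * h i t)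
        + of_real \<beta> * (\<Sum>i=0..k. X i * h i t) = (\<Sum>i=0..k. of_real (\<gamma> i * ts_poly T i t a))" for t
    proof -
      have "(\<Sum>i=0..k. X (Suc (Suc i)) * h i t) + 2 * of_real \<alpha> * (\<Sum>i=0..k. X (Suc i) * h i t)
        + of_real \<beta> * (\<Sum>i=0..k. X i * h i t)
        = (\<Sum>i=0..k. (X (Suc (Suc i)) + 2 * of_real \<alpha> * X (Suc i) + of_real \<beta> * X i) * h i t)"
        by (simp add: sum_distrib_left sum.distrib algebra_simps)
      also have "\<dots> = (\<Sum>i=0..k. of_real (\<gamma> i * ts_poly T i t a))"
        using X by (intro sum.cong) (auto simp: h_def)
      finally show ?thesis .
    qed
  qed
qed

text \<open>The common form of the real and the complex case; only the existence of exponentials has a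
  different proof in the two fields. As \<open>1 + \<lambda>\<^sub>1 \<mu>\<close> and \<open>1 + \<lambda>\<^sub>2 \<mu>\<close> have product \<open>1 - 2 \<alpha> \<mu> + \<beta> \<mu>\<^sup>2\<close>, both
  exponentials exist.\<close>

lemma general_solution_ts_exp:
  fixes r :: "'a::real_normed_field"
  assumes T: "closed T" and a: "a \<in> T" and S: "S \<subseteq> T" "card S = 3"
    and r: "r\<^sup>2 = of_real (\<alpha>\<^sup>2 - \<beta>)" "r \<noteq> 0" and \<beta>: "\<beta> \<noteq> 0" and k: "k \<ge> 1"
    and regr: "\<And>t. t \<in> ts_kappa T \<Longrightarrow> 1 - 2 * \<alpha> * ts_mu T t + \<beta> * (ts_mu T t)\<^sup>2 \<noteq> 0"
    and ex: "\<And>l::'a. (\<And>t. t \<in> ts_kappa T \<Longrightarrow> 1 + l * of_real (ts_mu T t) \<noteq> 0) \<Longrightarrow>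
      \<exists>e. e a = 1 \<and> (\<forall>t\<in>T. e t \<noteq> 0) \<and> (\<forall>t\<in>ts_kappa T. has_delta_derivative T e (l * e t) t)"
  shows "dynamic_solution T \<alpha> \<beta> (\<lambda>t. \<Sum>i=0..k. of_real (\<gamma> i * ts_poly T i t a)) y \<longleftrightarrow>
              (\<exists>c1 c2. \<forall>t\<in>T.
                 y t = c1 * ts_exp T (lambda1 \<alpha> r) t a + c2 * ts_exp T (lambda2 \<alpha> r) t a
                       + (\<Sum>i=0..k. xi \<alpha> \<beta> k \<gamma> r i * of_real (ts_poly T i t a)))"
proof -
  define l1 l2 where "l1 = lambda1 \<alpha> r" and "l2 = lambda2 \<alpha> r"
  have prod: "l1 * l2 = of_real \<beta>"
    using lambda_prod[OF r(1)] by (simp add: l1_def l2_def)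
  have sum: "l1 + l2 = - 2 * of_real \<alpha>"
    using lambda_sum[of \<alpha> r] by (simp add: l1_def l2_def)
  have "l2 - l1 = 2 * r" by (simp add: l1_def l2_def lambda1_def lambda2_def)
  then have neq: "l1 \<noteq> l2" using r(2) by auto
  have factor: "(1 + l1 * of_real m) * (1 + l2 * of_real m) = of_real (1 - 2 * \<alpha> * m + \<beta> * m\<^sup>2)" for m
  proof -
    have "(1 + l1 * of_real m) * (1 + l2 * of_real m) = 1 + (l1 + l2) * of_real m + (l1 * l2) * (of_real m)\<^sup>2"
      by (simp add: algebra_simps power2_eq_square)
    then show ?thesis unfolding sum prod by simp
  qed
  have "1 + l1 * of_real (ts_mu T t) \<noteq> 0" "1 + l2 * of_real (ts_mu T t) \<noteq> 0" if "t \<in> ts_kappa T" for t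
    using factor[of "ts_mu T t"] regr[OF that] by (metis mult_zero_left mult_zero_right of_real_eq_0_iff)+
  note reg = this
  obtain e1 where e1: "e1 a = 1" "\<And>t. t \<in> T \<Longrightarrow> e1 t \<noteq> 0"
      "\<And>t. t \<in> ts_kappa T \<Longrightarrow> has_delta_derivative T e1 (l1 * e1 t) t"
    using ex[OF reg(1)] by blast
  obtain e2 where e2: "e2 a = 1" "\<And>t. t \<in> T \<Longrightarrow> e2 t \<noteq> 0"
      "\<And>t. t \<in> ts_kappa T \<Longrightarrow> has_delta_derivative T e2 (l2 * e2 t) t"
    using ex[OF reg(2)] by blast
  show ?thesis
    using general_solution_from_particular[OF T S neq sum prod e1(2,3) e2(2,3) xi_polynomial_solution[OF T a S r \<beta> k]]
      ts_exp_eq[OF T a _ e1] ts_exp_eq[OF T a _ e2]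
    unfolding l1_def[symmetric] l2_def[symmetric] by simp
qed

theorem theorem1p1:
  fixes T :: "real set" and a \<alpha> \<beta> :: real and k :: nat and \<gamma> :: "nat \<Rightarrow> real"
  assumes "time_scale T" and "\<exists>S\<subseteq>T. card S = 3"
    and "a \<in> T"
    and "k \<ge> 1"
    and "\<beta> \<noteq> 0" and "\<beta> \<noteq> \<alpha>\<^sup>2"
    and "\<forall>t\<in>ts_kappa T. 1 - 2 * \<alpha> * ts_mu T t + \<beta> * (ts_mu T t)\<^sup>2 \<noteq> 0"
  shows "(\<beta> < \<alpha>\<^sup>2 \<longrightarrow>
           (\<forall>(r :: real) (y :: real \<Rightarrow> real). r = sqrt (\<alpha>\<^sup>2 - \<beta>) \<longrightarrow>
             (dynamic_solution T \<alpha> \<beta> (\<lambda>t. \<Sum>i=0..k. \<gamma> i * ts_poly T i t a) y \<longleftrightarrow>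
              (\<exists>c1 c2. \<forall>t\<in>T.
                 y t = c1 * ts_exp T (lambda1 \<alpha> r) t a + c2 * ts_exp T (lambda2 \<alpha> r) t a
                       + (\<Sum>i=0..k. xi \<alpha> \<beta> k \<gamma> r i * ts_poly T i t a)))))
       \<and> (\<alpha>\<^sup>2 < \<beta> \<longrightarrow>
           (\<forall>(r :: complex) (y :: real \<Rightarrow> complex). r\<^sup>2 = of_real (\<alpha>\<^sup>2 - \<beta>) \<longrightarrow>
             (dynamic_solution T \<alpha> \<beta> (\<lambda>t. \<Sum>i=0..k. of_real (\<gamma> i * ts_poly T i t a)) y \<longleftrightarrow>
              (\<exists>c1 c2. \<forall>t\<in>T.
                 y t = c1 * ts_exp T (lambda1 \<alpha> r) t a + c2 * ts_exp T (lambda2 \<alpha> r) t a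
                       + (\<Sum>i=0..k. xi \<alpha> \<beta> k \<gamma> r i * of_real (ts_poly T i t a))))))"
proof -
  have T: "closed T" using assms(1) by (simp add: time_scale_def)
  obtain S where S: "S \<subseteq> T" "card S = 3" using assms(2) by blast
  note regr = assms(7)[rule_format]
  have real_exp: "\<exists>e. e a = 1 \<and> (\<forall>t\<in>T. e t \<noteq> 0) \<and> (\<forall>t\<in>ts_kappa T. has_delta_derivative T e (l * e t) t)"
    if "\<And>t. t \<in> ts_kappa T \<Longrightarrow> 1 + l * of_real (ts_mu T t) \<noteq> 0" for l :: real
    using real_exponential_exists[OF T assms(3), of l] that by (metis of_real_eq_id id_apply)
  have complex_exp: "\<exists>e. e a = 1 \<and> (\<forall>t\<in>T. e t \<noteq> 0) \<and> (\<forall>t\<in>ts_kappa T. has_delta_derivative T e (l * e t) t)"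
    if "\<And>t. t \<in> ts_kappa T \<Longrightarrow> 1 + l * of_real (ts_mu T t) \<noteq> 0" for l :: complex
    using complex_exponential_exists[OF T assms(3) that] by metis
  have "r\<^sup>2 = of_real (\<alpha>\<^sup>2 - \<beta>) \<and> r \<noteq> 0" if "\<beta> < \<alpha>\<^sup>2" "r = sqrt (\<alpha>\<^sup>2 - \<beta>)" for r
    using that by simp
  note real_case = general_solution_ts_exp[OF T assms(3) S conjunct1[OF this] conjunct2[OF this] assms(5,4) regr real_exp]
  have "r \<noteq> 0" if "r\<^sup>2 = complex_of_real (\<alpha>\<^sup>2 - \<beta>)" for r
    using that assms(6) by (auto simp del: of_real_diff)
  note complex_case = general_solution_ts_exp[OF T assms(3) S _ this assms(5,4) regr complex_exp]
  show ?thesis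
    using real_case complex_case by (auto simp del: of_real_mult)
qed

end
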